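(* Let $N\ge1$, $1\le S\le N$, let $L=(L_1,\dots,L_S)$ be a band-width vector, let $\dot W$ be $L$-admissible and $W_\varepsilon=\mathrm{Id}+\varepsilon\dot W$, let $\beta\in\Gamma$, and let $\alpha\in\mathbb R^N$ be the $S$-banded vector with band vector $\beta$ and band-width vector $L$. Let $\mathcal P_\varepsilon$ be the associated transfer operator and fix $k\in\mathbb Z$. Then: (1) For all sufficiently small $\varepsilon>0$ (depending on $k$), $\mathcal P_\varepsilon$ has $N$ eigenfunctions of the form $F^{(\ell)}_{k,\varepsilon}(j,x)=f^{(\ell)}_{k,\varepsilon}(j)e^{2\pi i k x}$, $\ell=1,\dots,N$, whose eigenvalues $\lambda^{(1)}_{k,\varepsilon},\dots,\lambda^{(N)}_{k,\varepsilon}$ are pairwise distinct (these are the $N$ eigenvalues of $D_{k,\alpha}W_\varepsilon$, with $f^{(\ell)}_{k,\varepsilon}$ the corresponding eigenvectors). (2) These eigenvalues can be labelled so that $\lambda^{(\ell)}_{k,\varepsilon}\to e^{-2\pi i k\alpha_\ell}$ as $\varepsilon\to0$ for each $\ell$, and there exists an orthonormal basis $\{f^{(1)}_k,\dots,f^{(N)}_k\}$ of $\mathbb C^N$ such that, writing $F^{(\ell)}_k(j,x)=f^{(\ell)}_k(j)e^{2\pi i k x}$ and letting $\Pi^{(\ell)}_{k,\varepsilon}$, $\Pi^{(\ell)}_k:L^2(M)\to L^2(M)$ denote the $L^2$-orthogonal projections onto $\operatorname{span}\{F^{(\ell)}_{k,\varepsilon}\}$ and $\operatorname{span}\{F^{(\ell)}_k\}$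 respectively, we have $\Pi^{(\ell)}_{k,\varepsilon}\to\Pi^{(\ell)}_k$ in the $L^2(M)$ operator norm as $\varepsilon\to0$, for every $\ell$. Moreover: (a) if $S=1$ or $k=0$, $\{f^{(\ell)}_k\}_{\ell=1}^N$ is an orthonormal eigenbasis of $\dot W$; (b) if $S>1$ and $k\neq0$, $\{f^{(\ell)}_k\}_{\ell=1}^N$ is an orthonormal eigenbasis of $\hat P_{k,\beta,L}=D_{k,\beta,L}\hat W_L$, and for each $s\in\{1,\dots,S\}$ and each $\ell\in B_s$, the support of $f^{(\ell)}_k$ is contained in $B_s=\{N_{s-1}+1,\dots,N_s\}$.
   Context: $\mathbb S^1=\mathbb R/\mathbb Z$, $M=\{1,\dots,N\}\times\mathbb S^1$ with the product of the uniform probability on $\{1,\dots,N\}$ and Lebesgue measure; $L^2(M)$ is the complex $L^2$ space. For $\alpha\in\mathbb R^N$ and $\varepsilon\ge0$, $(\mathcal P_\varepsilon F)(j,x)=\sum_{j'=1}^N(W_\varepsilon)_{jj'}F(j',x-\alpha_j)$. For $k\in\mathbb Z$, $D_{k,\alpha}=\mathrm{Diag}(e^{-2\pi ik\alpha_1},\dots,e^{-2\pi ik\alpha_N})$. Band structure: a band-width vector is $L=(L_1,\dots,L_S)$ of positive integers with $\sum_s L_s=N$; set $N_0=0$, $N_s=N_{s-1}+L_s$, $B_s=\{j:N_{s-1}<j\le N_s\}$. Given distinct reals $\beta_1,\dots,\beta_S$ (the band vector), the $S$-banded vector $\alpha$ is defined by $\alpha_j=\beta_s$ for $j\in B_s$.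 Then $D_{k,\beta,L}:=D_{k,\alpha}$ is block diagonal with blocks $e^{-2\pi ik\beta_s}\mathrm{Id}_{L_s}$. $L$-admissible: $\dot W$ is a real symmetric $N\times N$ matrix such that (1) $\dot W_{ij}\ge0$ for $i\ne j$ and $\sum_j\dot W_{ij}=0$ for all $i$; (2) $\dot W$ has $N$ distinct eigenvalues; (3) for each $s$, the $L_s\times L_s$ submatrix $\hat W_s=(\dot W_{jk})_{j,k\in B_s}$ has $L_s$ distinct eigenvalues. $\hat W_L$ is the block-diagonal matrix with diagonal blocks $\hat W_1,\dots,\hat W_S$, and $\hat P_{k,\beta,L}=D_{k,\beta,L}\hat W_L$. $\Gamma=\{\beta\in\mathbb R^S: e^{-2\pi ik\beta_{s_1}}\neq e^{-2\pi ik\beta_{s_2}}\text{ for all }k\in\mathbb Z\setminus\{0\}\text{ and all }s_1\neq s_2\}$. *)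

theory Defs
  imports "HOL-Analysis.Analysis"
begin

text \<open>Indices are 1-based throughout: j ranges over {1..N}, s over {1..S}.
  Vectors in C^N are functions nat => complex, matrices are nat => nat => _ ,
  functions on M = {1..N} x S^1 are nat => real => complex, periodic functions
  on R being identified with functions on S^1 = R/Z.\<close>

definition Nsum :: "(nat \<Rightarrow> nat) \<Rightarrow> nat \<Rightarrow> nat" where
  "Nsum L s = (\<Sum>t\<in>{1..s}. L t)"

definition band :: "(nat \<Rightarrow> nat) \<Rightarrow> nat \<Rightarrow> nat set" where
  "band L s = {j. Nsum L (s - 1) < j \<and> j \<le> Nsum L s}"

definition bandwidth_vector :: "nat \<Rightarrow> nat \<Rightarrow> (nat \<Rightarrow> nat) \<Rightarrow> bool" where
  "bandwidth_vector N S L \<longleftrightarrow> (\<forall>s\<in>{1..S}. 0 < L s) \<and> (\<Sum>s\<in>{1..S}. L s) = N"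

definition real_eigs_on :: "nat set \<Rightarrow> (nat \<Rightarrow> nat \<Rightarrow> real) \<Rightarrow> real set" where
  "real_eigs_on I A = {\<mu>. \<exists>v::nat \<Rightarrow> real. (\<exists>i\<in>I. v i \<noteq> 0) \<and>
      (\<forall>i\<in>I. (\<Sum>j\<in>I. A i j * v j) = \<mu> * v i)}"

definition cmat_eigs :: "nat \<Rightarrow> (nat \<Rightarrow> nat \<Rightarrow> complex) \<Rightarrow> complex set" where
  "cmat_eigs N A = {\<mu>. \<exists>v::nat \<Rightarrow> complex. (\<exists>i\<in>{1..N}. v i \<noteq> 0) \<and>
      (\<forall>i\<in>{1..N}. (\<Sum>j\<in>{1..N}. A i j * v j) = \<mu> * v i)}"

definition is_cmat_eigvec :: "nat \<Rightarrow> (nat \<Rightarrow> nat \<Rightarrow> complex) \<Rightarrow> (nat \<Rightarrow> complex) \<Rightarrow> complex \<Rightarrow> bool" where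
  "is_cmat_eigvec N A v \<mu> \<longleftrightarrow> (\<exists>i\<in>{1..N}. v i \<noteq> 0) \<and>
      (\<forall>i\<in>{1..N}. (\<Sum>j\<in>{1..N}. A i j * v j) = \<mu> * v i)"

definition L_admissible :: "nat \<Rightarrow> nat \<Rightarrow> (nat \<Rightarrow> nat) \<Rightarrow> (nat \<Rightarrow> nat \<Rightarrow> real) \<Rightarrow> bool" where
  "L_admissible N S L Wd \<longleftrightarrow>
     (\<forall>i\<in>{1..N}. \<forall>j\<in>{1..N}. Wd i j = Wd j i) \<and>
     (\<forall>i\<in>{1..N}. \<forall>j\<in>{1..N}. i \<noteq> j \<longrightarrow> 0 \<le> Wd i j) \<and>
     (\<forall>i\<in>{1..N}. (\<Sum>j\<in>{1..N}. Wd i j) = 0) \<and>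
     card (real_eigs_on {1..N} Wd) = N \<and>
     (\<forall>s\<in>{1..S}. card (real_eigs_on (band L s) Wd) = L s)"

definition Gamma_set :: "nat \<Rightarrow> (nat \<Rightarrow> real) \<Rightarrow> bool" where
  "Gamma_set S \<beta> \<longleftrightarrow> (\<forall>k::int. k \<noteq> 0 \<longrightarrow> (\<forall>s1\<in>{1..S}. \<forall>s2\<in>{1..S}. s1 \<noteq> s2 \<longrightarrow>
      exp (- 2 * pi * \<i> * of_int k * of_real (\<beta> s1)) \<noteq> exp (- 2 * pi * \<i> * of_int k * of_real (\<beta> s2))))"

definition Weps :: "(nat \<Rightarrow> nat \<Rightarrow> real) \<Rightarrow> real \<Rightarrow> nat \<Rightarrow> nat \<Rightarrow> real" where
  "Weps Wd \<epsilon> i j = (if i = j then 1 else 0) + \<epsilon> * Wd i j"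

definition Dka :: "int \<Rightarrow> (nat \<Rightarrow> real) \<Rightarrow> nat \<Rightarrow> complex" where
  "Dka k \<alpha> j = exp (- 2 * pi * \<i> * of_int k * of_real (\<alpha> j))"

definition DW :: "int \<Rightarrow> (nat \<Rightarrow> real) \<Rightarrow> (nat \<Rightarrow> nat \<Rightarrow> real) \<Rightarrow> nat \<Rightarrow> nat \<Rightarrow> complex" where
  "DW k \<alpha> W i j = Dka k \<alpha> i * of_real (W i j)"

definition What :: "nat \<Rightarrow> (nat \<Rightarrow> nat) \<Rightarrow> (nat \<Rightarrow> nat \<Rightarrow> real) \<Rightarrow> nat \<Rightarrow> nat \<Rightarrow> real" where
  "What S L Wd i j = (if \<exists>s\<in>{1..S}. i \<in> band L s \<and> j \<in> band L s then Wd i j else 0)"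

text \<open>hat P_{k,beta,L} = D_{k,beta,L} hat W_L; D_{k,beta,L} is the diagonal matrix with entry
  exp(-2 pi i k beta_s) on band s.\<close>
definition Dkb :: "int \<Rightarrow> nat \<Rightarrow> (nat \<Rightarrow> nat) \<Rightarrow> (nat \<Rightarrow> real) \<Rightarrow> nat \<Rightarrow> complex" where
  "Dkb k S L \<beta> j = (\<Sum>s\<in>{s\<in>{1..S}. j \<in> band L s}. exp (- 2 * pi * \<i> * of_int k * of_real (\<beta> s)))"

definition Phat :: "int \<Rightarrow> nat \<Rightarrow> (nat \<Rightarrow> nat) \<Rightarrow> (nat \<Rightarrow> real) \<Rightarrow> (nat \<Rightarrow> nat \<Rightarrow> real) \<Rightarrow> nat \<Rightarrow> nat \<Rightarrow> complex" where
  "Phat k S L \<beta> Wd i j = Dkb k S L \<beta> i * of_real (What S L Wd i j)"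

definition transfer :: "nat \<Rightarrow> (nat \<Rightarrow> real) \<Rightarrow> (nat \<Rightarrow> nat \<Rightarrow> real) \<Rightarrow> (nat \<Rightarrow> real \<Rightarrow> complex) \<Rightarrow> nat \<Rightarrow> real \<Rightarrow> complex" where
  "transfer N \<alpha> W F j x = (\<Sum>j'\<in>{1..N}. of_real (W j j') * F j' (x - \<alpha> j))"

definition efun :: "int \<Rightarrow> (nat \<Rightarrow> complex) \<Rightarrow> nat \<Rightarrow> real \<Rightarrow> complex" where
  "efun k f j x = f j * exp (2 * pi * \<i> * of_int k * of_real x)"

definition cinner :: "nat \<Rightarrow> (nat \<Rightarrow> complex) \<Rightarrow> (nat \<Rightarrow> complex) \<Rightarrow> complex" where
  "cinner N f g = (\<Sum>j\<in>{1..N}. f j * cnj (g j))"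

text \<open>L^2(M): uniform probability on {1..N} times Lebesgue measure on S^1 = [0,1).\<close>
definition L2space :: "nat \<Rightarrow> (nat \<Rightarrow> real \<Rightarrow> complex) set" where
  "L2space N = {G. \<forall>j\<in>{1..N}. set_borel_measurable lborel {0..<1} (G j) \<and>
      set_integrable lborel {0..<1} (\<lambda>x. (cmod (G j x))\<^sup>2)}"

definition L2inner :: "nat \<Rightarrow> (nat \<Rightarrow> real \<Rightarrow> complex) \<Rightarrow> (nat \<Rightarrow> real \<Rightarrow> complex) \<Rightarrow> complex" where
  "L2inner N G H = (1 / of_nat N) * (\<Sum>j\<in>{1..N}. (LINT x:{0..<1}|lborel. G j x * cnj (H j x)))"

definition L2norm :: "nat \<Rightarrow> (nat \<Rightarrow> real \<Rightarrow> complex) \<Rightarrow> real" where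
  "L2norm N G = sqrt (Re (L2inner N G G))"

definition projL2 :: "nat \<Rightarrow> (nat \<Rightarrow> real \<Rightarrow> complex) \<Rightarrow> (nat \<Rightarrow> real \<Rightarrow> complex) \<Rightarrow> nat \<Rightarrow> real \<Rightarrow> complex" where
  "projL2 N F G j x = (L2inner N G F / L2inner N F F) * F j x"

definition opnormL2 :: "nat \<Rightarrow> ((nat \<Rightarrow> real \<Rightarrow> complex) \<Rightarrow> (nat \<Rightarrow> real \<Rightarrow> complex)) \<Rightarrow> real" where
  "opnormL2 N T = Sup {L2norm N (T G) | G. G \<in> L2space N \<and> L2norm N G \<le> 1}"

end

theory Submission
  imports Defs "Jordan_Normal_Form.Char_Poly"
begin

text \<open>Both cases of the theorem concern the level sets of the diagonal of \<open>D\<close>: a single one if \<open>S = 1\<close>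
  or \<open>k = 0\<close>, and the bands otherwise. On each level set the compression of \<open>W\<close> is symmetric with
  distinct eigenvalues, so choosing eigenvectors gives a real orthonormal basis \<open>\<phi>\<close> of \<open>\<complex>\<^sup>N\<close> whose
  \<open>l\<close>-th member is supported in the level set of \<open>l\<close>. In this basis \<open>D (Id + \<epsilon> W)\<close> becomes
  \<open>D (Id + \<epsilon> B)\<close>, where \<open>B\<close> is diagonal with distinct entries on every level set. An eigenvector
  normalised by \<open>c l = 1\<close> has \<open>1 + \<epsilon> (B c) l\<close> as eigenvalue up to the factor \<open>d l\<close>; eliminating the
  eigenvalue, and cancelling \<open>\<epsilon>\<close> in the rows of the level set of \<open>l\<close>, puts the eigenvector equation into
  the form \<open>c = \<epsilon> \<Psi>(c)\<close> with a polynomial \<open>\<Psi>\<close> independent of \<open>\<epsilon>\<close>. For small \<open>\<epsilon>\<close> this is a contraction,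
  and its fixed point tends to the \<open>l\<close>-th unit vector. The \<open>N\<close> eigenvalues obtained are distinct at
  order \<open>1\<close> or at order \<open>\<epsilon>\<close>, hence they are all the eigenvalues. The projections all act within the
  \<open>k\<close>-th Fourier mode, where they are given by the matrices \<open>f f\<^sup>* / |f|\<^sup>2\<close>.\<close>

section \<open>Linear algebra\<close>

text \<open>A one-sided inverse of a square matrix is two-sided, so \<open>Q * R = 1\<close> for
  \<open>R\<close> the transpose of \<open>Q\<close> gives \<open>R * Q = 1\<close>. This is the
  completeness relation needed to expand vectors in the basis \<open>\<phi>\<close>. The
  \<open>Suc\<close> shifts pass from indices \<open>1..N\<close> to the matrix indices
  \<open>0..N-1\<close>.\<close>

lemma orthonormal_rows_imp_columns:
  fixes \<phi> :: "nat \<Rightarrow> nat \<Rightarrow> real"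
  assumes orth: "\<And>l m. l \<in> {1..N} \<Longrightarrow> m \<in> {1..N} \<Longrightarrow>
    (\<Sum>i\<in>{1..N}. \<phi> l i * \<phi> m i) = (if l = m then 1 else 0)"
    and i: "i \<in> {1..N}" and j: "j \<in> {1..N}"
  shows "(\<Sum>l\<in>{1..N}. \<phi> l i * \<phi> l j) = (if i = j then 1 else 0)"
proof -
  define Q where "Q = Matrix.mat N N (\<lambda>(a,b). \<phi> (Suc a) (Suc b))"
  define R where "R = Matrix.mat N N (\<lambda>(a,b). \<phi> (Suc b) (Suc a))"
  have Q: "Q \<in> carrier_mat N N" and R: "R \<in> carrier_mat N N"
    by (auto simp: Q_def R_def)
  have "Q * R = 1\<^sub>m N"
  proof (rule eq_matI)
    fix a b assume "a < dim_row (1\<^sub>m N :: real mat)" "b < dim_col (1\<^sub>m N :: real mat)"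
    then have ab: "a < N" "b < N" by auto
    have "(\<Sum>k<N. \<phi> (Suc a) (Suc k) * \<phi> (Suc b) (Suc k)) = (if a = b then 1 else 0)"
      using orth[of "Suc a" "Suc b"] ab by (simp add: sum.atLeast1_atMost_eq)
    then show "(Q * R) $$ (a, b) = 1\<^sub>m N $$ (a, b)"
      using ab by (simp add: Q_def R_def scalar_prod_def lessThan_atLeast0)
  qed (auto simp: Q_def R_def)
  then have RQ: "R * Q = 1\<^sub>m N"
    by (rule mat_mult_left_right_inverse[OF Q R])
  define a b where "a = i - 1" and "b = j - 1"
  have ab: "a < N" "b < N" "i = Suc a" "j = Suc b"
    using i j by (auto simp: a_def b_def)
  have "(R * Q) $$ (a, b) = (\<Sum>k<N. \<phi> (Suc k) i * \<phi> (Suc k) j)"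
    using ab by (simp add: Q_def R_def scalar_prod_def lessThan_atLeast0)
  then show ?thesis
    using ab by (simp add: RQ sum.atLeast1_atMost_eq)
qed

text \<open>Eigenvalues are roots of the characteristic polynomial, which is monic of degree
  \<open>N\<close>. The bound serves to show that \<open>N\<close> distinct eigenvalues, once found,
  exhaust the spectrum.\<close>

lemma finite_card_cmat_eigs:
  shows "finite (cmat_eigs N A)" and "card (cmat_eigs N A) \<le> N"
proof -
  define M where "M = Matrix.mat N N (\<lambda>(a,b). A (Suc a) (Suc b))"
  have M: "M \<in> carrier_mat N N" by (auto simp: M_def)
  have sub: "cmat_eigs N A \<subseteq> {x. poly (char_poly M) x = 0}"
  proof
    fix \<mu> assume "\<mu> \<in> cmat_eigs N A"
    then obtain v i where v: "i \<in> {1..N}" "v i \<noteq> 0"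
      "\<And>i. i \<in> {1..N} \<Longrightarrow> (\<Sum>j\<in>{1..N}. A i j * v j) = \<mu> * v i"
      unfolding cmat_eigs_def by blast
    define w where "w = Matrix.vec N (\<lambda>a. v (Suc a))"
    have "w \<noteq> 0\<^sub>v N"
    proof
      assume "w = 0\<^sub>v N"
      moreover have "i - 1 < N" "Suc (i - 1) = i" using v(1) by auto
      ultimately have "vec_index w (i - 1) = 0" by simp
      with \<open>i - 1 < N\<close> \<open>Suc (i - 1) = i\<close> v(2) show False by (simp add: w_def)
    qed
    moreover have "M *\<^sub>v w = \<mu> \<cdot>\<^sub>v w"
    proof (rule eq_vecI)
      fix a assume "a < dim_vec (\<mu> \<cdot>\<^sub>v w)"
      then have a: "a < N" by (simp add: w_def)
      have "(\<Sum>k<N. A (Suc a) (Suc k) * v (Suc k)) = \<mu> * v (Suc a)"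
        using v(3)[of "Suc a"] a by (simp add: sum.atLeast1_atMost_eq)
      then show "vec_index (M *\<^sub>v w) a = vec_index (\<mu> \<cdot>\<^sub>v w) a"
        using a by (simp add: M_def w_def scalar_prod_def lessThan_atLeast0)
    qed (simp add: M_def w_def)
    ultimately have "eigenvalue M \<mu>"
      unfolding eigenvalue_def eigenvector_def by (intro exI[of _ w]) (simp add: M_def w_def)
    then show "\<mu> \<in> {x. poly (char_poly M) x = 0}"
      using eigenvalue_root_char_poly[OF M] by simp
  qed
  have deg: "degree (char_poly M) = N" and "char_poly M \<noteq> 0"
    using degree_monic_char_poly[OF M] by auto
  then have fin: "finite {x. poly (char_poly M) x = 0}"
    and "card {x. poly (char_poly M) x = 0} \<le> N"
    using poly_roots_finite card_poly_roots_bound[of "char_poly M"] by auto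
  with sub show "finite (cmat_eigs N A)" "card (cmat_eigs N A) \<le> N"
    by (auto intro: finite_subset dest: card_mono[OF fin])
qed

text \<open>The spectrum is indexed by \<open>I\<close> itself through a bijection
  \<open>\<mu>\<close>. One eigenvector per eigenvalue is then enough: symmetry makes them
  orthogonal, and it remains to normalise them and to extend them by zero outside
  \<open>I\<close>.\<close>

lemma distinct_eigs_orthonormal_eigenbasis:
  assumes fin: "finite I" and sym: "\<And>i j. i \<in> I \<Longrightarrow> j \<in> I \<Longrightarrow> A i j = A j i"
    and card: "card (real_eigs_on I A) = card I"
  shows "\<exists>(\<phi> :: nat \<Rightarrow> nat \<Rightarrow> real) \<mu>. inj_on \<mu> I \<and> (\<forall>l\<in>I. \<forall>i. i \<notin> I \<longrightarrow> \<phi> l i = 0) \<and>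
    (\<forall>l\<in>I. \<forall>m\<in>I. (\<Sum>i\<in>I. \<phi> l i * \<phi> m i) = (if l = m then 1 else 0)) \<and>
    (\<forall>l\<in>I. \<forall>i\<in>I. (\<Sum>j\<in>I. A i j * \<phi> l j) = \<mu> l * \<phi> l i)"
proof (cases "I = {}")
  case True
  then show ?thesis by simp
next
  case False
  \<comment> \<open>Infinite sets have \<open>card\<close> equal to 0, so finiteness of the spectrum
    follows from its cardinality being positive; hence the separate case of empty
    \<open>I\<close>.\<close>
  then have "card (real_eigs_on I A) > 0" using card fin by (simp add: card_gt_0_iff)
  then have "finite (real_eigs_on I A)" by (simp add: card_gt_0_iff)
  then obtain \<mu> where \<mu>: "bij_betw \<mu> I (real_eigs_on I A)"
    using finite_same_card_bij[OF fin] card by metis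
  have "\<forall>l\<in>I. \<exists>v. (\<exists>i\<in>I. v i \<noteq> 0) \<and> (\<forall>i\<in>I. (\<Sum>j\<in>I. A i j * v j) = \<mu> l * v i)"
    using \<mu> unfolding bij_betw_def real_eigs_on_def by blast
  then obtain v where v0: "\<And>l. l \<in> I \<Longrightarrow> \<exists>i\<in>I. v l i \<noteq> 0"
    and v: "\<And>l i. l \<in> I \<Longrightarrow> i \<in> I \<Longrightarrow> (\<Sum>j\<in>I. A i j * v l j) = \<mu> l * v l i"
    by metis
  \<comment> \<open>The pairing of \<open>A v l\<close> with \<open>v m\<close> is evaluated on
    either side, by symmetry of \<open>A\<close>, giving a factor \<open>\<mu> l\<close> or
    \<open>\<mu> m\<close>.\<close>
  have orth: "(\<Sum>i\<in>I. v l i * v m i) = 0" if "l \<in> I" "m \<in> I" "l \<noteq> m" for l m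
  proof -
    have "\<mu> l * (\<Sum>i\<in>I. v l i * v m i) = (\<Sum>i\<in>I. (\<Sum>j\<in>I. A i j * v l j) * v m i)"
      using v that by (simp add: sum_distrib_left mult.assoc)
    also have "\<dots> = (\<Sum>i\<in>I. \<Sum>j\<in>I. A i j * v l j * v m i)"
      by (simp add: sum_distrib_right)
    also have "\<dots> = (\<Sum>j\<in>I. \<Sum>i\<in>I. A i j * v l j * v m i)"
      by (rule sum.swap)
    also have "\<dots> = (\<Sum>j\<in>I. (\<Sum>i\<in>I. A j i * v m i) * v l j)"
      unfolding sum_distrib_right using sym by (intro sum.cong) (auto simp: mult_ac)
    also have "\<dots> = \<mu> m * (\<Sum>i\<in>I. v l i * v m i)"
      using v that by (simp add: sum_distrib_left mult_ac)
    finally have "(\<mu> l - \<mu> m) * (\<Sum>i\<in>I. v l i * v m i) = 0"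
      by (simp add: left_diff_distrib)
    moreover have "\<mu> l \<noteq> \<mu> m"
      using \<mu> that by (auto simp: bij_betw_def inj_on_def)
    ultimately show ?thesis by simp
  qed
  define n where "n l = sqrt (\<Sum>i\<in>I. v l i * v l i)" for l
  have n: "n l \<noteq> 0" "n l * n l = (\<Sum>i\<in>I. v l i * v l i)" if "l \<in> I" for l
  proof -
    obtain i where i: "i \<in> I" "v l i \<noteq> 0" using v0 \<open>l \<in> I\<close> by blast
    have "(\<Sum>i\<in>I. v l i * v l i) > 0"
      using fin i by (intro sum_pos2[of I i]) (auto simp: zero_less_mult_iff)
    then show "n l \<noteq> 0" "n l * n l = (\<Sum>i\<in>I. v l i * v l i)"
      by (auto simp: n_def)
  qed
  define \<phi> where "\<phi> l i = (if i \<in> I then v l i / n l else 0)" for l i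
  show ?thesis
  proof (intro exI[of _ \<phi>] exI[of _ \<mu>] conjI ballI allI impI)
    show "inj_on \<mu> I" using \<mu> by (simp add: bij_betw_def)
    show "\<phi> l i = 0" if "i \<notin> I" for l i using that by (simp add: \<phi>_def)
    show "(\<Sum>j\<in>I. A i j * \<phi> l j) = \<mu> l * \<phi> l i" if "l \<in> I" "i \<in> I" for l i
    proof -
      have "(\<Sum>j\<in>I. A i j * \<phi> l j) = (\<Sum>j\<in>I. A i j * v l j) / n l"
        unfolding sum_divide_distrib by (intro sum.cong) (auto simp: \<phi>_def)
      then show ?thesis using that v by (simp add: \<phi>_def)
    qed
    show "(\<Sum>i\<in>I. \<phi> l i * \<phi> m i) = (if l = m then 1 else 0)" if "l \<in> I" "m \<in> I" for l m
    proof -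
      have "(\<Sum>i\<in>I. \<phi> l i * \<phi> m i) = (\<Sum>i\<in>I. v l i * v m i) / (n l * n m)"
        unfolding sum_divide_distrib by (intro sum.cong) (auto simp: \<phi>_def)
      then show ?thesis using that orth n[of l] by auto
    qed
  qed
qed

section \<open>Bounded Lipschitz functions on the unit polydisc\<close>

text \<open>A single constant serves as sup bound and as Lipschitz constant for the sup distance on
  \<open>J\<close>, so that the property passes to sums and products and hence to polynomials.
  Quantifying over every bound \<open>r\<close> of the coordinate differences avoids a maximum over
  a possibly empty \<open>J\<close>. With \<open>r = 0\<close> it also says that \<open>g\<close>
  depends on the coordinates in \<open>J\<close> only.\<close>

definition lip_box_with :: "nat set \<Rightarrow> real \<Rightarrow> ((nat \<Rightarrow> complex) \<Rightarrow> complex) \<Rightarrow> bool" where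
  "lip_box_with J K g \<longleftrightarrow> 0 \<le> K \<and> (\<forall>u. (\<forall>j\<in>J. cmod (u j) \<le> 1) \<longrightarrow> cmod (g u) \<le> K) \<and>
     (\<forall>u v r. (\<forall>j\<in>J. cmod (u j) \<le> 1) \<longrightarrow> (\<forall>j\<in>J. cmod (v j) \<le> 1) \<longrightarrow>
       (\<forall>j\<in>J. cmod (u j - v j) \<le> r) \<longrightarrow> 0 \<le> r \<longrightarrow> cmod (g u - g v) \<le> K * r)"

abbreviation lip_box :: "nat set \<Rightarrow> ((nat \<Rightarrow> complex) \<Rightarrow> complex) \<Rightarrow> bool" where
  "lip_box J g \<equiv> \<exists>K. lip_box_with J K g"

lemma lip_box_withI:
  assumes "0 \<le> K"
    and "\<And>u. \<forall>j\<in>J. cmod (u j) \<le> 1 \<Longrightarrow> cmod (g u) \<le> K"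
    and "\<And>u v r. \<forall>j\<in>J. cmod (u j) \<le> 1 \<Longrightarrow> \<forall>j\<in>J. cmod (v j) \<le> 1 \<Longrightarrow>
      \<forall>j\<in>J. cmod (u j - v j) \<le> r \<Longrightarrow> 0 \<le> r \<Longrightarrow> cmod (g u - g v) \<le> K * r"
  shows "lip_box_with J K g"
  using assms by (simp add: lip_box_with_def)

lemma lip_box_withD:
  assumes "lip_box_with J K g"
  shows "0 \<le> K"
    and "\<And>u. \<forall>j\<in>J. cmod (u j) \<le> 1 \<Longrightarrow> cmod (g u) \<le> K"
    and "\<And>u v r. \<forall>j\<in>J. cmod (u j) \<le> 1 \<Longrightarrow> \<forall>j\<in>J. cmod (v j) \<le> 1 \<Longrightarrow>
      \<forall>j\<in>J. cmod (u j - v j) \<le> r \<Longrightarrow> 0 \<le> r \<Longrightarrow> cmod (g u - g v) \<le> K * r"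
  using assms by (simp_all add: lip_box_with_def)

lemma lip_box_const: "lip_box J (\<lambda>u. c)"
  by (rule exI[of _ "cmod c"], rule lip_box_withI) auto

lemma lip_box_coord: "j \<in> J \<Longrightarrow> lip_box J (\<lambda>u. u j)"
  by (rule exI[of _ 1], rule lip_box_withI) auto

lemma lip_box_add:
  assumes "lip_box J g" "lip_box J h"
  shows "lip_box J (\<lambda>u. g u + h u)"
proof -
  from assms obtain K M where K: "lip_box_with J K g" and M: "lip_box_with J M h" by blast
  have "lip_box_with J (K + M) (\<lambda>u. g u + h u)"
  proof (rule lip_box_withI)
    show "0 \<le> K + M" using lip_box_withD(1)[OF K] lip_box_withD(1)[OF M] by simp
    show "cmod (g u + h u) \<le> K + M" if "\<forall>j\<in>J. cmod (u j) \<le> 1" for u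
      using lip_box_withD(2)[OF K that] lip_box_withD(2)[OF M that] norm_triangle_ineq[of "g u" "h u"] by linarith
    show "cmod (g u + h u - (g v + h v)) \<le> (K + M) * r"
      if "\<forall>j\<in>J. cmod (u j) \<le> 1" "\<forall>j\<in>J. cmod (v j) \<le> 1"
        "\<forall>j\<in>J. cmod (u j - v j) \<le> r" "0 \<le> r" for u v r
    proof -
      have "cmod (g u + h u - (g v + h v)) \<le> cmod (g u - g v) + cmod (h u - h v)"
        by (rule norm_diff_triangle_ineq)
      also have "\<dots> \<le> K * r + M * r"
        using lip_box_withD(3)[OF K that] lip_box_withD(3)[OF M that] by linarith
      finally show ?thesis by (simp add: distrib_right)
    qed
  qed
  then show ?thesis ..
qed

lemma lip_box_mult:
  assumes "lip_box J g" "lip_box J h"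
  shows "lip_box J (\<lambda>u. g u * h u)"
proof -
  from assms obtain K M where K: "lip_box_with J K g" and M: "lip_box_with J M h" by blast
  note K0 = lip_box_withD(1)[OF K] and M0 = lip_box_withD(1)[OF M]
  \<comment> \<open>The product rule contributes \<open>K * M\<close> twice to the Lipschitz
    constant, whence the factor 2.\<close>
  have "lip_box_with J (2 * (K * M)) (\<lambda>u. g u * h u)"
  proof (rule lip_box_withI)
    show "0 \<le> 2 * (K * M)" using K0 M0 by simp
    show "cmod (g u * h u) \<le> 2 * (K * M)" if "\<forall>j\<in>J. cmod (u j) \<le> 1" for u
    proof -
      have "cmod (g u * h u) \<le> K * M"
        unfolding norm_mult
        by (rule mult_mono[OF lip_box_withD(2)[OF K that] lip_box_withD(2)[OF M that] K0 norm_ge_zero])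
      moreover have "0 \<le> K * M" using K0 M0 by simp
      ultimately show ?thesis by linarith
    qed
    show "cmod (g u * h u - g v * h v) \<le> 2 * (K * M) * r"
      if "\<forall>j\<in>J. cmod (u j) \<le> 1" "\<forall>j\<in>J. cmod (v j) \<le> 1"
        "\<forall>j\<in>J. cmod (u j - v j) \<le> r" "0 \<le> r" for u v r
    proof -
      have "cmod (g u * h u - g v * h v) = cmod (g u * (h u - h v) + (g u - g v) * h v)"
        by (simp add: algebra_simps)
      also have "\<dots> \<le> cmod (g u) * cmod (h u - h v) + cmod (g u - g v) * cmod (h v)"
        by (metis norm_triangle_ineq norm_mult)
      also have "\<dots> \<le> K * (M * r) + (K * r) * M"
      proof (rule add_mono)
        show "cmod (g u) * cmod (h u - h v) \<le> K * (M * r)"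
          by (rule mult_mono[OF lip_box_withD(2)[OF K that(1)] lip_box_withD(3)[OF M that] K0 norm_ge_zero])
        show "cmod (g u - g v) * cmod (h v) \<le> (K * r) * M"
          by (rule mult_mono[OF lip_box_withD(3)[OF K that] lip_box_withD(2)[OF M that(2)] _ norm_ge_zero])
            (use K0 that(4) in simp)
      qed
      finally show ?thesis by (simp add: mult_ac)
    qed
  qed
  then show ?thesis ..
qed

lemma lip_box_diff:
  "lip_box J g \<Longrightarrow> lip_box J h \<Longrightarrow> lip_box J (\<lambda>u. g u - h u)"
  using lip_box_add[of J g "\<lambda>u. (- 1) * h u"] lip_box_mult[OF lip_box_const[of J "- 1"], of h] by simp

lemma lip_box_sum:
  assumes "\<And>n. n \<in> X \<Longrightarrow> lip_box J (g n)"
  shows "lip_box J (\<lambda>u. \<Sum>n\<in>X. g n u)"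
  using assms by (induction X rule: infinite_finite_induct) (simp_all add: lip_box_const lip_box_add)

lemma lip_box_divide_const: "lip_box J g \<Longrightarrow> lip_box J (\<lambda>u. g u / c)"
  unfolding divide_inverse by (rule lip_box_mult[OF _ lip_box_const])

text \<open>Banach's iteration started at zero: for \<open>\<epsilon> * K \<le> 1 / 2\<close> the
  map \<open>\<epsilon> * \<Psi>\<close> sends the unit polydisc into the polydisc of radius
  \<open>K * \<epsilon>\<close> and halves distances. As \<open>K\<close> is independent of
  \<open>\<epsilon>\<close>, the fixed point is of order \<open>\<epsilon>\<close>.\<close>

lemma lip_box_fixed_point:
  assumes fin: "finite J" and lip: "\<And>j. j \<in> J \<Longrightarrow> lip_box J (\<lambda>u. \<Psi> u j)"
  obtains K where "0 < K"
    and "\<And>\<epsilon>. 0 < \<epsilon> \<Longrightarrow> \<epsilon> * K \<le> 1 / 2 \<Longrightarrow>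
      \<exists>u. \<forall>j\<in>J. cmod (u j) \<le> K * \<epsilon> \<and> u j = of_real \<epsilon> * \<Psi> u j"
proof -
  from lip have "\<forall>j\<in>J. \<exists>K. lip_box_with J K (\<lambda>u. \<Psi> u j)" by blast
  from bchoice[OF this] obtain k where k: "\<And>j. j \<in> J \<Longrightarrow> lip_box_with J (k j) (\<lambda>u. \<Psi> u j)" by blast
  \<comment> \<open>The sum dominates each \<open>k j\<close>; the summand 1 makes \<open>K\<close>
    positive in every case.\<close>
  define K where "K = 1 + (\<Sum>j\<in>J. k j)"
  have K0: "0 < K" using lip_box_withD(1)[OF k] by (simp add: K_def add_pos_nonneg sum_nonneg)
  have kK: "k j \<le> K" if "j \<in> J" for j
    using member_le_sum[OF that, of k] lip_box_withD(1)[OF k] fin by (simp add: K_def)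
  have \<Psi>K: "cmod (\<Psi> u j) \<le> K" if "j \<in> J" "\<forall>j\<in>J. cmod (u j) \<le> 1" for u j
    using lip_box_withD(2)[OF k[OF that(1)] that(2)] kK[OF that(1)] by linarith
  have \<Psi>L: "cmod (\<Psi> u j - \<Psi> v j) \<le> K * r" if "j \<in> J" "\<forall>j\<in>J. cmod (u j) \<le> 1"
    "\<forall>j\<in>J. cmod (v j) \<le> 1" "\<forall>j\<in>J. cmod (u j - v j) \<le> r" "0 \<le> r" for u v j r
    using lip_box_withD(3)[OF k[OF that(1)] that(2-)] mult_right_mono[OF kK[OF that(1)] that(5)] by linarith
  show ?thesis
  proof (rule that[OF K0])
    fix \<epsilon> :: real assume \<epsilon>: "0 < \<epsilon>" "\<epsilon> * K \<le> 1 / 2"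
    define T where "T u j = of_real \<epsilon> * \<Psi> u j" for u j
    define U where "U n = (T ^^ n) (\<lambda>_. 0)" for n
    have U0: "U 0 j = 0" and US: "U (Suc n) = T (U n)" for n j by (simp_all add: U_def)
    have TK: "cmod (T u j) \<le> K * \<epsilon>" if "j \<in> J" "\<forall>j\<in>J. cmod (u j) \<le> 1" for u j
      using \<Psi>K[OF that] \<epsilon> by (simp add: T_def norm_mult)
    have TL: "cmod (T u j - T v j) \<le> r / 2" if "j \<in> J" "\<forall>j\<in>J. cmod (u j) \<le> 1"
      "\<forall>j\<in>J. cmod (v j) \<le> 1" "\<forall>j\<in>J. cmod (u j - v j) \<le> r" "0 \<le> r" for u v j r
    proof -
      have "cmod (T u j - T v j) = \<epsilon> * cmod (\<Psi> u j - \<Psi> v j)"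
        using \<epsilon> by (simp add: T_def norm_mult flip: right_diff_distrib)
      also have "\<dots> \<le> \<epsilon> * (K * r)" using \<Psi>L[OF that] \<epsilon> by simp
      also have "\<dots> \<le> 1 / 2 * r"
        unfolding mult.assoc[symmetric] by (rule mult_right_mono[OF \<epsilon>(2) that(5)])
      finally show ?thesis by simp
    qed
    have UK: "cmod (U n j) \<le> K * \<epsilon>" if "j \<in> J" for n j
      using that
    proof (induction n arbitrary: j)
      case 0
      then show ?case using K0 \<epsilon> by (simp add: U0)
    next
      case (Suc n)
      have "K * \<epsilon> \<le> 1" using \<epsilon> by (simp add: mult.commute)
      then have "\<forall>j\<in>J. cmod (U n j) \<le> 1" using Suc.IH by force
      then show ?case using TK Suc.prems by (simp add: US)
    qed
    have U1: "\<forall>j\<in>J. cmod (U n j) \<le> 1" for n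
      using UK[of _ n] \<epsilon> by (force simp: mult.commute)
    have step: "cmod (U (Suc n) j - U n j) \<le> (1/2) ^ n" if "j \<in> J" for n j
      using that
    proof (induction n arbitrary: j)
      case 0
      then show ?case using U1[of "Suc 0"] by (simp add: U0)
    next
      case (Suc n)
      then show ?case using TL[OF Suc.prems U1[of "Suc n"] U1[of n], of "(1/2)^n"] by (simp add: US)
    qed
    \<comment> \<open>The increments telescope to \<open>U n j\<close> and are dominated by a
      geometric series.\<close>
    have conv: "convergent (\<lambda>n. U n j)" if "j \<in> J" for j
    proof -
      have "summable (\<lambda>n. U (Suc n) j - U n j)"
        by (rule summable_comparison_test'[of "\<lambda>n. (1/2 :: real) ^ n" 0])
          (use step[OF that] in \<open>auto intro: summable_geometric\<close>)
      then show ?thesis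
        using summable_iff_convergent[of "\<lambda>n. U (Suc n) j - U n j"] by (simp add: sum_lessThan_telescope[of "\<lambda>n. U n j"] U0)
    qed
    define u where "u j = lim (\<lambda>n. U n j)" for j
    have lim: "(\<lambda>n. U n j) \<longlonglongrightarrow> u j" if "j \<in> J" for j
      using conv[OF that] by (simp add: u_def convergent_LIMSEQ_iff)
    have uK: "cmod (u j) \<le> K * \<epsilon>" if "j \<in> J" for j
      by (rule tendsto_upperbound[OF tendsto_norm[OF lim[OF that]]]) (use UK that in auto)
    have u1: "\<forall>j\<in>J. cmod (u j) \<le> 1"
      using uK \<epsilon> by (force simp: mult.commute)
    have "u j = T u j" if j: "j \<in> J" for j
    proof (rule LIMSEQ_unique[OF LIMSEQ_Suc[OF lim[OF j]]])
      \<comment> \<open>The \<open>J\<close>-sum of the coordinate distances bounds each of them, so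
        it is a common radius for \<open>TL\<close>, and it tends to zero because \<open>J\<close>
        is finite.\<close>
      define r where "r n = (\<Sum>i\<in>J. cmod (U n i - u i))" for n
      have "r \<longlonglongrightarrow> (\<Sum>i\<in>J. cmod (u i - u i))"
        unfolding r_def by (intro tendsto_intros lim)
      then have "(\<lambda>n. r n / 2) \<longlonglongrightarrow> 0" using tendsto_divide_zero by force
      moreover have "\<forall>\<^sub>F n in sequentially. norm (U (Suc n) j - T u j) \<le> r n / 2"
        unfolding US
        by (intro always_eventually allI TL j U1 u1)
          (auto simp: r_def sum_nonneg fin intro!: member_le_sum)
      ultimately have "(\<lambda>n. U (Suc n) j - T u j) \<longlonglongrightarrow> 0"
        by (rule Lim_null_comparison[rotated])
      then show "(\<lambda>n. U (Suc n) j) \<longlonglongrightarrow> T u j" by (simp add: LIM_zero_iff)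
    qed
    then show "\<exists>u. \<forall>j\<in>J. cmod (u j) \<le> K * \<epsilon> \<and> u j = of_real \<epsilon> * \<Psi> u j"
      using uK by (intro exI[of _ u]) (simp add: T_def)
  qed
qed

section \<open>Perturbation of a diagonal matrix\<close>

text \<open>Normalising the \<open>l\<close>-th coordinate to 1 makes row \<open>l\<close> an
  identity that determines the eigenvalue. The remaining rows form a fixed point problem for the
  coordinates in \<open>I - {l}\<close>, whose solution is of order \<open>\<epsilon>\<close>; this
  gives the limit of \<open>c\<close>.\<close>

lemma near_diagonal_eigenvector:
  fixes B :: "nat \<Rightarrow> nat \<Rightarrow> complex" and d \<mu> :: "nat \<Rightarrow> complex"
  assumes fin: "finite I" and l: "l \<in> I"
    and diag: "\<And>m n. m \<in> I \<Longrightarrow> n \<in> I \<Longrightarrow> d m = d n \<Longrightarrow> B m n = (if m = n then \<mu> m else 0)"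
    and dist: "\<And>m. m \<in> I \<Longrightarrow> m \<noteq> l \<Longrightarrow> d m = d l \<Longrightarrow> \<mu> m \<noteq> \<mu> l"
  shows "\<exists>c :: real \<Rightarrow> nat \<Rightarrow> complex.
    (\<forall>m\<in>I. ((\<lambda>\<epsilon>. c \<epsilon> m) \<longlongrightarrow> (if m = l then 1 else 0)) (at_right 0)) \<and>
    (\<forall>\<^sub>F \<epsilon> in at_right 0. \<forall>m\<in>I. d m * (c \<epsilon> m + of_real \<epsilon> * (\<Sum>n\<in>I. B m n * c \<epsilon> n))
      = d l * (1 + of_real \<epsilon> * (\<Sum>n\<in>I. B l n * c \<epsilon> n)) * c \<epsilon> m)"
proof -
  define J where "J = I - {l}"
  define F where "F = {n\<in>I. d n \<noteq> d l}"
  define e where "e u n = (if n = l then 1 else u n)" for u :: "nat \<Rightarrow> complex" and n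
  define Be where "Be u m = (\<Sum>n\<in>I. B m n * e u n)" for u m
  \<comment> \<open>With \<open>c = e u\<close>, a row with \<open>d m \<noteq> d l\<close> reads
    \<open>(d m - d l) * c m = \<epsilon> * (d l * Be u l * c m - d m * Be u m)\<close>, that is,
    \<open>c m = \<epsilon> * q u m\<close>.\<close>
  define q where "q u m = (d l * Be u l * e u m - d m * Be u m) / (d m - d l)" for u m
  \<comment> \<open>A row with \<open>d m = d l\<close> reduces to
    \<open>Be u m = Be u l * c m\<close>. The diagonal terms of \<open>B\<close> combine to
    \<open>(\<mu> l - \<mu> m) * c m\<close>, and what remains is a sum over \<open>F\<close> of
    multiples of \<open>c n\<close>. Substituting \<open>c n = \<epsilon> * q u n\<close> there
    restores the factor \<open>\<epsilon>\<close> that was cancelled.\<close>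
  define \<Psi> where "\<Psi> u m = (if d m \<noteq> d l then q u m
      else (\<Sum>n\<in>F. (B m n - B l n * e u m) * q u n) / (\<mu> l - \<mu> m))" for u m
  have lip_e: "lip_box J (\<lambda>u. e u n)" if "n \<in> I" for n
    using that by (cases "n = l") (auto simp: e_def J_def intro: lip_box_const lip_box_coord)
  have lip_Be: "lip_box J (\<lambda>u. Be u m)" for m
    unfolding Be_def by (intro lip_box_sum lip_box_mult lip_box_const lip_e)
  have lip_q: "lip_box J (\<lambda>u. q u m)" if "m \<in> I" for m
    unfolding q_def
    by (intro lip_box_divide_const lip_box_diff lip_box_mult lip_box_const lip_e lip_Be that)
  have lip_\<Psi>: "lip_box J (\<lambda>u. \<Psi> u m)" if "m \<in> J" for m
  proof (cases "d m \<noteq> d l")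
    case True
    then show ?thesis using lip_q that by (simp add: \<Psi>_def J_def)
  next
    case False
    have "m \<in> I" using that by (simp add: J_def)
    then have "lip_box J (\<lambda>u. (\<Sum>n\<in>F. (B m n - B l n * e u m) * q u n) / (\<mu> l - \<mu> m))"
      by (intro lip_box_divide_const lip_box_sum lip_box_diff lip_box_mult lip_box_const lip_e lip_q)
        (auto simp: F_def)
    then show ?thesis using False by (simp add: \<Psi>_def)
  qed
  have finJ: "finite J" using fin by (simp add: J_def)
  obtain K where K: "0 < K" and fp: "\<And>\<epsilon>. 0 < \<epsilon> \<Longrightarrow> \<epsilon> * K \<le> 1 / 2 \<Longrightarrow>
      \<exists>u. \<forall>j\<in>J. cmod (u j) \<le> K * \<epsilon> \<and> u j = of_real \<epsilon> * \<Psi> u j"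
    using lip_box_fixed_point[where \<Psi> = \<Psi>, OF finJ lip_\<Psi>] by blast
  have "\<exists>u. \<forall>\<epsilon>. 0 < \<epsilon> \<and> \<epsilon> * K \<le> 1 / 2 \<longrightarrow>
      (\<forall>j\<in>J. cmod (u \<epsilon> j) \<le> K * \<epsilon> \<and> u \<epsilon> j = of_real \<epsilon> * \<Psi> (u \<epsilon>) j)"
    using fp by (intro choice) blast
  then obtain u where u: "\<And>\<epsilon> j. 0 < \<epsilon> \<Longrightarrow> \<epsilon> * K \<le> 1 / 2 \<Longrightarrow> j \<in> J \<Longrightarrow> cmod (u \<epsilon> j) \<le> K * \<epsilon>"
    "\<And>\<epsilon> j. 0 < \<epsilon> \<Longrightarrow> \<epsilon> * K \<le> 1 / 2 \<Longrightarrow> j \<in> J \<Longrightarrow> u \<epsilon> j = of_real \<epsilon> * \<Psi> (u \<epsilon>) j"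
    by blast
  have ev: "\<forall>\<^sub>F \<epsilon> in at_right 0. 0 < \<epsilon> \<and> \<epsilon> * K \<le> 1 / 2"
    by (rule eventually_at_rightI[of 0 "1 / (2 * K)"]) (use K in \<open>auto simp: field_simps\<close>)
  define c where "c \<epsilon> = e (u \<epsilon>)" for \<epsilon>
  have "((\<lambda>\<epsilon>. c \<epsilon> m) \<longlongrightarrow> (if m = l then 1 else 0)) (at_right 0)" if "m \<in> I" for m
  proof (cases "m = l")
    case True
    then show ?thesis by (simp add: c_def e_def)
  next
    case False
    with that have "m \<in> J" by (simp add: J_def)
    have "((\<lambda>\<epsilon>. K * \<epsilon>) \<longlongrightarrow> K * 0) (at_right 0)" by (intro tendsto_intros)
    then have "((\<lambda>\<epsilon>. K * \<epsilon>) \<longlongrightarrow> 0) (at_right 0)" by simp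
    moreover have "\<forall>\<^sub>F \<epsilon> in at_right 0. norm (c \<epsilon> m) \<le> K * \<epsilon>"
      using ev by eventually_elim (use u(1) \<open>m \<in> J\<close> False in \<open>simp add: c_def e_def\<close>)
    ultimately have "((\<lambda>\<epsilon>. c \<epsilon> m) \<longlongrightarrow> 0) (at_right 0)"
      by (rule Lim_null_comparison[rotated])
    then show ?thesis using False by simp
  qed
  moreover have "\<forall>\<^sub>F \<epsilon> in at_right 0. \<forall>m\<in>I. d m * (c \<epsilon> m + of_real \<epsilon> * (\<Sum>n\<in>I. B m n * c \<epsilon> n))
        = d l * (1 + of_real \<epsilon> * (\<Sum>n\<in>I. B l n * c \<epsilon> n)) * c \<epsilon> m"
    using ev
  proof eventually_elim
    case (elim \<epsilon>)
    define w where "w = u \<epsilon>"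
    have w: "w j = of_real \<epsilon> * \<Psi> w j" if "j \<in> J" for j
      using u(2) elim that by (simp add: w_def)
    have wF: "e w n = of_real \<epsilon> * q w n" if "n \<in> F" for n
      using that w[of n] by (auto simp: F_def J_def \<Psi>_def e_def)
    \<comment> \<open>Within the degenerate group of l only the diagonal of B survives.\<close>
    have Be: "Be w m = \<mu> m * e w m + (\<Sum>n\<in>F. B m n * e w n)" if "m \<in> I" "d m = d l" for m
    proof -
      have "I = F \<union> {n\<in>I. d n = d l}" by (auto simp: F_def)
      then have "Be w m = (\<Sum>n\<in>F \<union> {n\<in>I. d n = d l}. B m n * e w n)" by (simp add: Be_def)
      also have "\<dots> = (\<Sum>n\<in>F. B m n * e w n) + (\<Sum>n\<in>{n\<in>I. d n = d l}. B m n * e w n)"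
        using fin by (intro sum.union_disjoint) (auto simp: F_def)
      also have "(\<Sum>n\<in>{n\<in>I. d n = d l}. B m n * e w n)
          = (\<Sum>n\<in>{n\<in>I. d n = d l}. if m = n then \<mu> m * e w m else 0)"
        using that diag by (intro sum.cong) auto
      also have "\<dots> = \<mu> m * e w m" using fin that by simp
      finally show ?thesis by simp
    qed
    show ?case
    proof
      fix m assume m: "m \<in> I"
      have "d m * (e w m + of_real \<epsilon> * Be w m) = d l * (1 + of_real \<epsilon> * Be w l) * e w m"
      proof (cases "d m = d l")
        case False
        then have "e w m = of_real \<epsilon> * ((d l * Be w l * e w m - d m * Be w m) / (d m - d l))"
          using wF[of m] m by (simp add: F_def q_def)
        then have "(d m - d l) * e w m = of_real \<epsilon> * (d l * Be w l * e w m - d m * Be w m)"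
          using False by (simp add: divide_simps mult_ac)
        then show ?thesis by (simp add: algebra_simps)
      next
        case True
        have "Be w m = Be w l * e w m"
        proof (cases "m = l")
          case True
          then show ?thesis by (simp add: e_def)
        next
          case False
          then have "e w m = of_real \<epsilon> * ((\<Sum>n\<in>F. (B m n - B l n * e w m) * q w n) / (\<mu> l - \<mu> m))"
            using w[of m] m True by (simp add: J_def \<Psi>_def e_def)
          then have "(\<mu> l - \<mu> m) * e w m = (\<Sum>n\<in>F. (B m n - B l n * e w m) * (of_real \<epsilon> * q w n))"
            using dist[OF m False True] by (simp add: divide_simps sum_distrib_left mult_ac)
          also have "\<dots> = (\<Sum>n\<in>F. (B m n - B l n * e w m) * e w n)"
            using wF by simp
          also have "\<dots> = (\<Sum>n\<in>F. B m n * e w n) - (\<Sum>n\<in>F. B l n * e w n) * e w m"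
            by (simp add: sum_subtractf sum_distrib_left algebra_simps)
          finally have "(\<mu> l - \<mu> m) * e w m
              = (\<Sum>n\<in>F. B m n * e w n) - (\<Sum>n\<in>F. B l n * e w n) * e w m" .
          moreover have "Be w l = \<mu> l + (\<Sum>n\<in>F. B l n * e w n)"
            using Be[OF l] by (simp add: e_def)
          ultimately show ?thesis using Be[OF m True] by (simp add: algebra_simps)
        qed
        then show ?thesis using True by (simp add: algebra_simps)
      qed
      then show "d m * (c \<epsilon> m + of_real \<epsilon> * (\<Sum>n\<in>I. B m n * c \<epsilon> n))
        = d l * (1 + of_real \<epsilon> * (\<Sum>n\<in>I. B l n * c \<epsilon> n)) * c \<epsilon> m"
        by (simp add: c_def Be_def w_def)
    qed
  qed
  ultimately show ?thesis by (intro exI[of _ c] conjI ballI)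
qed

text \<open>The equation \<open>eig\<close> concerns only the rows in the level set of
  \<open>l\<close>: \<open>\<phi> l\<close> is an eigenvector of the compression of
  \<open>W\<close>. The part of \<open>W \<phi> l\<close> in other rows gives the entries of
  \<open>B\<close> between different level sets, which do not affect the limits.\<close>

lemma perturbed_eigensystem:
  fixes d :: "nat \<Rightarrow> complex" and W \<phi> :: "nat \<Rightarrow> nat \<Rightarrow> real" and \<mu> :: "nat \<Rightarrow> real"
  assumes d0: "\<And>l. l \<in> {1..N} \<Longrightarrow> d l \<noteq> 0"
    and orth: "\<And>l m. l \<in> {1..N} \<Longrightarrow> m \<in> {1..N} \<Longrightarrow>
      (\<Sum>i\<in>{1..N}. \<phi> l i * \<phi> m i) = (if l = m then 1 else 0)"
    and supp: "\<And>l i. l \<in> {1..N} \<Longrightarrow> i \<in> {1..N} \<Longrightarrow> d i \<noteq> d l \<Longrightarrow> \<phi> l i = 0"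
    and eig: "\<And>l i. l \<in> {1..N} \<Longrightarrow> i \<in> {1..N} \<Longrightarrow> d i = d l \<Longrightarrow>
      (\<Sum>j\<in>{1..N}. W i j * \<phi> l j) = \<mu> l * \<phi> l i"
    and dist: "\<And>l m. l \<in> {1..N} \<Longrightarrow> m \<in> {1..N} \<Longrightarrow> l \<noteq> m \<Longrightarrow> d l = d m \<Longrightarrow> \<mu> l \<noteq> \<mu> m"
  shows "\<exists>(f :: nat \<Rightarrow> real \<Rightarrow> nat \<Rightarrow> complex) lam.
    (\<forall>l\<in>{1..N}. \<forall>j. ((\<lambda>\<epsilon>. f l \<epsilon> j) \<longlongrightarrow> of_real (\<phi> l j)) (at_right 0)) \<and>
    (\<forall>l\<in>{1..N}. (lam l \<longlongrightarrow> d l) (at_right 0)) \<and>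
    (\<forall>\<^sub>F \<epsilon> in at_right 0.
      (\<forall>l\<in>{1..N}. is_cmat_eigvec N (\<lambda>i j. d i * of_real (Weps W \<epsilon> i j)) (f l \<epsilon>) (lam l \<epsilon>)) \<and>
      inj_on (\<lambda>l. lam l \<epsilon>) {1..N} \<and>
      (\<lambda>l. lam l \<epsilon>) ` {1..N} = cmat_eigs N (\<lambda>i j. d i * of_real (Weps W \<epsilon> i j)))"
proof -
  define I where "I = {1..N}"
  have fin: "finite I" by (simp add: I_def)
  note d0 = d0[folded I_def] and orth = orth[folded I_def] and supp = supp[folded I_def]
    and eig = eig[folded I_def] and dist = dist[folded I_def]
  define W\<phi> where "W\<phi> n i = (\<Sum>j\<in>I. W i j * \<phi> n j)" for n i
  define B where "B m n = (\<Sum>i\<in>I. \<phi> m i * W\<phi> n i)" for m n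
  \<comment> \<open>Expansion of \<open>W \<phi> n\<close> in the basis \<open>\<phi>\<close>, by
    orthonormality of the columns.\<close>
  have W\<phi>: "W\<phi> n i = (\<Sum>p\<in>I. \<phi> p i * B p n)" if "i \<in> I" for n i
  proof -
    have "(\<Sum>p\<in>I. \<phi> p i * B p n) = (\<Sum>p\<in>I. \<Sum>j\<in>I. \<phi> p i * \<phi> p j * W\<phi> n j)"
      by (simp add: B_def sum_distrib_left mult.assoc)
    also have "\<dots> = (\<Sum>j\<in>I. \<Sum>p\<in>I. \<phi> p i * \<phi> p j * W\<phi> n j)" by (rule sum.swap)
    also have "\<dots> = (\<Sum>j\<in>I. (\<Sum>p\<in>I. \<phi> p i * \<phi> p j) * W\<phi> n j)"
      by (simp add: sum_distrib_right)
    also have "\<dots> = (\<Sum>j\<in>I. if i = j then W\<phi> n j else 0)"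
      using orthonormal_rows_imp_columns[of N \<phi> i] orth that
      by (intro sum.cong) (auto simp: I_def)
    finally show ?thesis using that fin by simp
  qed
  have diag: "complex_of_real (B m n) = (if m = n then of_real (\<mu> m) else 0)"
    if "m \<in> I" "n \<in> I" "d m = d n" for m n
  proof -
    have "B m n = (\<Sum>i\<in>I. \<mu> n * (\<phi> m i * \<phi> n i))"
      unfolding B_def
    proof (rule sum.cong[OF refl])
      fix i assume i: "i \<in> I"
      show "\<phi> m i * W\<phi> n i = \<mu> n * (\<phi> m i * \<phi> n i)"
        using supp[OF that(1) i] eig[OF that(2) i] that(3)
        by (cases "d i = d m") (auto simp: W\<phi>_def)
    qed
    also have "\<dots> = (if m = n then \<mu> m else 0)"
      using orth[OF that(1,2)] by (simp flip: sum_distrib_left)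
    finally show ?thesis by simp
  qed
  have "\<forall>l\<in>I. \<exists>c :: real \<Rightarrow> nat \<Rightarrow> complex.
      (\<forall>m\<in>I. ((\<lambda>\<epsilon>. c \<epsilon> m) \<longlongrightarrow> (if m = l then 1 else 0)) (at_right 0)) \<and>
      (\<forall>\<^sub>F \<epsilon> in at_right 0. \<forall>m\<in>I. d m * (c \<epsilon> m + of_real \<epsilon> * (\<Sum>n\<in>I. of_real (B m n) * c \<epsilon> n))
        = d l * (1 + of_real \<epsilon> * (\<Sum>n\<in>I. of_real (B l n) * c \<epsilon> n)) * c \<epsilon> m)"
  proof
    fix l assume l: "l \<in> I"
    have dist_l: "complex_of_real (\<mu> m) \<noteq> of_real (\<mu> l)" if "m \<in> I" "m \<noteq> l" "d m = d l" for m
      using dist[OF that(1) l that(2,3)] by simp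
    show "\<exists>c :: real \<Rightarrow> nat \<Rightarrow> complex.
      (\<forall>m\<in>I. ((\<lambda>\<epsilon>. c \<epsilon> m) \<longlongrightarrow> (if m = l then 1 else 0)) (at_right 0)) \<and>
      (\<forall>\<^sub>F \<epsilon> in at_right 0. \<forall>m\<in>I. d m * (c \<epsilon> m + of_real \<epsilon> * (\<Sum>n\<in>I. of_real (B m n) * c \<epsilon> n))
        = d l * (1 + of_real \<epsilon> * (\<Sum>n\<in>I. of_real (B l n) * c \<epsilon> n)) * c \<epsilon> m)"
      by (rule near_diagonal_eigenvector[where d = d and B = "\<lambda>m n. of_real (B m n)"
            and \<mu> = "\<lambda>m. of_real (\<mu> m)", OF fin l diag dist_l])
  qed
  from bchoice[OF this] obtain c :: "nat \<Rightarrow> real \<Rightarrow> nat \<Rightarrow> complex" where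
    c_lim: "\<And>l m. l \<in> I \<Longrightarrow> m \<in> I \<Longrightarrow>
      ((\<lambda>\<epsilon>. c l \<epsilon> m) \<longlongrightarrow> (if m = l then 1 else 0)) (at_right 0)"
    and c_eig: "\<And>l. l \<in> I \<Longrightarrow> \<forall>\<^sub>F \<epsilon> in at_right 0. \<forall>m\<in>I.
      d m * (c l \<epsilon> m + of_real \<epsilon> * (\<Sum>n\<in>I. of_real (B m n) * c l \<epsilon> n))
        = d l * (1 + of_real \<epsilon> * (\<Sum>n\<in>I. of_real (B l n) * c l \<epsilon> n)) * c l \<epsilon> m"
    by blast
  define \<nu> where "\<nu> l \<epsilon> = (\<Sum>n\<in>I. of_real (B l n) * c l \<epsilon> n)" for l \<epsilon>
  define lam where "lam l \<epsilon> = d l * (1 + of_real \<epsilon> * \<nu> l \<epsilon>)" for l \<epsilon>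
  define f where "f l \<epsilon> j = (\<Sum>m\<in>I. c l \<epsilon> m * of_real (\<phi> m j))" for l \<epsilon> j
  have \<epsilon>_lim: "((\<lambda>\<epsilon>. complex_of_real \<epsilon>) \<longlongrightarrow> 0) (at_right 0)"
    using tendsto_of_real[OF tendsto_ident_at, of 0 "{0<..}", where 'a = complex] by simp
  have \<nu>_lim: "(\<nu> l \<longlongrightarrow> of_real (\<mu> l)) (at_right 0)" if l: "l \<in> I" for l
  proof -
    have "(\<nu> l \<longlongrightarrow> (\<Sum>n\<in>I. of_real (B l n) * (if n = l then 1 else 0))) (at_right 0)"
      unfolding \<nu>_def[abs_def] by (intro tendsto_sum tendsto_mult tendsto_const c_lim l)
    also have "(\<Sum>n\<in>I. of_real (B l n) * (if n = l then 1 else 0)) = complex_of_real (B l l)"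
      using l fin by (simp add: if_distrib cong: if_cong)
    also have "\<dots> = of_real (\<mu> l)" using diag[OF l l] by simp
    finally show ?thesis .
  qed
  have lam_lim: "(lam l \<longlongrightarrow> d l) (at_right 0)" if l: "l \<in> I" for l
  proof -
    have "(lam l \<longlongrightarrow> d l * (1 + 0 * of_real (\<mu> l))) (at_right 0)"
      unfolding lam_def[abs_def] by (intro tendsto_intros \<epsilon>_lim \<nu>_lim l)
    then show ?thesis by simp
  qed
  have f_lim: "((\<lambda>\<epsilon>. f l \<epsilon> j) \<longlongrightarrow> of_real (\<phi> l j)) (at_right 0)" if l: "l \<in> I" for l j
  proof -
    have "((\<lambda>\<epsilon>. f l \<epsilon> j) \<longlongrightarrow> (\<Sum>m\<in>I. (if m = l then 1 else 0) * of_real (\<phi> m j))) (at_right 0)"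
      unfolding f_def by (intro tendsto_sum tendsto_mult tendsto_const c_lim l)
    also have "(\<Sum>m\<in>I. (if m = l then 1 else 0) * of_real (\<phi> m j)) = complex_of_real (\<phi> l j)"
      using l fin by (simp add: if_distrib[of "\<lambda>x. x * _"] cong: if_cong)
    finally show ?thesis .
  qed
  have eigvec: "\<forall>\<^sub>F \<epsilon> in at_right 0.
      is_cmat_eigvec N (\<lambda>i j. d i * of_real (Weps W \<epsilon> i j)) (f l \<epsilon>) (lam l \<epsilon>)" if l: "l \<in> I" for l
  proof -
    have "\<exists>i\<in>I. \<phi> l i \<noteq> 0"
    proof (rule ccontr)
      assume "\<not> (\<exists>i\<in>I. \<phi> l i \<noteq> 0)"
      then have "(\<Sum>i\<in>I. \<phi> l i * \<phi> l i) = 0" by simp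
      then show False using orth[OF l l] by simp
    qed
    then obtain i where i: "i \<in> I" "complex_of_real (\<phi> l i) \<noteq> 0" by auto
    \<comment> \<open>An entry where the limit \<open>\<phi> l\<close> is nonzero stays nonzero for
      small \<open>\<epsilon>\<close>, so \<open>f l \<epsilon>\<close> is a genuine
      eigenvector.\<close>
    have "\<forall>\<^sub>F \<epsilon> in at_right 0. f l \<epsilon> i \<noteq> 0"
      by (rule tendsto_imp_eventually_ne[OF f_lim[OF l] i(2)])
    with c_eig[OF l] show ?thesis
    proof eventually_elim
      case (elim \<epsilon>)
      have "(\<Sum>j\<in>I. d i * of_real (Weps W \<epsilon> i j) * f l \<epsilon> j) = lam l \<epsilon> * f l \<epsilon> i" if i: "i \<in> I" for i
      proof -
        have 1: "(\<Sum>j\<in>I. of_real (W i j) * f l \<epsilon> j)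
            = (\<Sum>p\<in>I. of_real (\<phi> p i) * (\<Sum>n\<in>I. of_real (B p n) * c l \<epsilon> n))"
        proof -
          have "(\<Sum>j\<in>I. of_real (W i j) * f l \<epsilon> j)
              = (\<Sum>j\<in>I. \<Sum>n\<in>I. of_real (W i j * \<phi> n j) * c l \<epsilon> n)"
            by (simp add: f_def sum_distrib_left mult_ac)
          also have "\<dots> = (\<Sum>n\<in>I. \<Sum>j\<in>I. of_real (W i j * \<phi> n j) * c l \<epsilon> n)" by (rule sum.swap)
          also have "\<dots> = (\<Sum>n\<in>I. of_real (W\<phi> n i) * c l \<epsilon> n)"
            by (simp add: W\<phi>_def sum_distrib_right)
          also have "\<dots> = (\<Sum>n\<in>I. \<Sum>p\<in>I. of_real (\<phi> p i) * (of_real (B p n) * c l \<epsilon> n))"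
            using i by (simp add: W\<phi> sum_distrib_right mult.assoc)
          also have "\<dots> = (\<Sum>p\<in>I. \<Sum>n\<in>I. of_real (\<phi> p i) * (of_real (B p n) * c l \<epsilon> n))"
            by (rule sum.swap)
          finally show ?thesis by (simp add: sum_distrib_left)
        qed
        have "(\<Sum>j\<in>I. d i * of_real (Weps W \<epsilon> i j) * f l \<epsilon> j)
            = (\<Sum>j\<in>I. (if i = j then d i * f l \<epsilon> j else 0) + d i * of_real \<epsilon> * (of_real (W i j) * f l \<epsilon> j))"
          by (intro sum.cong) (auto simp: Weps_def algebra_simps)
        also have "\<dots> = d i * f l \<epsilon> i + d i * of_real \<epsilon> * (\<Sum>j\<in>I. of_real (W i j) * f l \<epsilon> j)"
          using i fin by (simp add: sum.distrib sum_distrib_left)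
        also have "\<dots> = (\<Sum>p\<in>I. d i * of_real (\<phi> p i)
            * (c l \<epsilon> p + of_real \<epsilon> * (\<Sum>n\<in>I. of_real (B p n) * c l \<epsilon> n)))"
          unfolding 1 unfolding f_def by (simp add: sum_distrib_left distrib_left sum.distrib mult_ac)
        \<comment> \<open>Since \<open>\<phi> p\<close> is supported in the level set of
          \<open>p\<close>, it is an eigenvector of the diagonal matrix \<open>d\<close>, and
          \<open>d i\<close> may be replaced by \<open>d p\<close>.\<close>
        also have "\<dots> = (\<Sum>p\<in>I. of_real (\<phi> p i)
            * (d p * (c l \<epsilon> p + of_real \<epsilon> * (\<Sum>n\<in>I. of_real (B p n) * c l \<epsilon> n))))"
        proof (rule sum.cong[OF refl])
          fix p assume "p \<in> I"
          then have "d i = d p \<or> \<phi> p i = 0" using supp i by blast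
          then show "d i * of_real (\<phi> p i) * (c l \<epsilon> p + of_real \<epsilon> * (\<Sum>n\<in>I. of_real (B p n) * c l \<epsilon> n))
            = of_real (\<phi> p i) * (d p * (c l \<epsilon> p + of_real \<epsilon> * (\<Sum>n\<in>I. of_real (B p n) * c l \<epsilon> n)))"
            by auto
        qed
        also have "\<dots> = (\<Sum>p\<in>I. of_real (\<phi> p i) * (lam l \<epsilon> * c l \<epsilon> p))"
          using elim(1) by (simp add: lam_def \<nu>_def)
        also have "\<dots> = lam l \<epsilon> * f l \<epsilon> i"
          by (simp add: f_def sum_distrib_left mult_ac)
        finally show ?thesis .
      qed
      then show ?case
        using elim(2) i unfolding is_cmat_eigvec_def I_def by blast
    qed
  qed
  have neq: "\<forall>\<^sub>F \<epsilon> in at_right 0. lam l \<epsilon> \<noteq> lam m \<epsilon>" if lm: "l \<in> I" "m \<in> I" "l \<noteq> m" for l m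
  proof (cases "d l = d m")
    case False
    have "((\<lambda>\<epsilon>. lam l \<epsilon> - lam m \<epsilon>) \<longlongrightarrow> d l - d m) (at_right 0)"
      by (intro tendsto_diff lam_lim lm)
    from tendsto_imp_eventually_ne[OF this, of 0] False show ?thesis by simp
  next
    case True
    \<comment> \<open>On a common level set \<open>lam l - lam m\<close> equals
      \<open>d l * \<epsilon> * (\<nu> l - \<nu> m)\<close>, so the separation comes from the limits
      \<open>\<mu> l\<close> and \<open>\<mu> m\<close>.\<close>
    have "((\<lambda>\<epsilon>. \<nu> l \<epsilon> - \<nu> m \<epsilon>) \<longlongrightarrow> of_real (\<mu> l) - of_real (\<mu> m)) (at_right 0)"
      by (intro tendsto_diff \<nu>_lim lm)
    then have "\<forall>\<^sub>F \<epsilon> in at_right 0. \<nu> l \<epsilon> - \<nu> m \<epsilon> \<noteq> 0"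
      by (rule tendsto_imp_eventually_ne) (use dist[OF lm True] in simp)
    with eventually_at_right_less[of 0] show ?thesis
    proof eventually_elim
      case (elim \<epsilon>)
      then show ?case using d0[OF lm(1)] d0[OF lm(2)] True by (simp add: lam_def)
    qed
  qed
  have "\<forall>\<^sub>F \<epsilon> in at_right 0. \<forall>l\<in>I. is_cmat_eigvec N (\<lambda>i j. d i * of_real (Weps W \<epsilon> i j)) (f l \<epsilon>) (lam l \<epsilon>)"
    using eigvec by (intro eventually_ball_finite fin ballI)
  moreover have "\<forall>\<^sub>F \<epsilon> in at_right 0. \<forall>l\<in>I. \<forall>m\<in>I. l \<noteq> m \<longrightarrow> lam l \<epsilon> \<noteq> lam m \<epsilon>"
  proof (intro eventually_ball_finite fin ballI)
    fix l m assume "l \<in> I" "m \<in> I"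
    then show "\<forall>\<^sub>F \<epsilon> in at_right 0. l \<noteq> m \<longrightarrow> lam l \<epsilon> \<noteq> lam m \<epsilon>"
      using neq by (cases "l = m") simp_all
  qed
  ultimately have "\<forall>\<^sub>F \<epsilon> in at_right 0.
      (\<forall>l\<in>I. is_cmat_eigvec N (\<lambda>i j. d i * of_real (Weps W \<epsilon> i j)) (f l \<epsilon>) (lam l \<epsilon>)) \<and>
      inj_on (\<lambda>l. lam l \<epsilon>) I \<and>
      (\<lambda>l. lam l \<epsilon>) ` I = cmat_eigs N (\<lambda>i j. d i * of_real (Weps W \<epsilon> i j))"
  proof eventually_elim
    case (elim \<epsilon>)
    have inj: "inj_on (\<lambda>l. lam l \<epsilon>) I" using elim(2) by (auto simp: inj_on_def)
    \<comment> \<open>The matrix has at most N eigenvalues and N distinct ones are already known.\<close>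
    have "(\<lambda>l. lam l \<epsilon>) ` I = cmat_eigs N (\<lambda>i j. d i * of_real (Weps W \<epsilon> i j))"
    proof (rule card_seteq)
      show "(\<lambda>l. lam l \<epsilon>) ` I \<subseteq> cmat_eigs N (\<lambda>i j. d i * of_real (Weps W \<epsilon> i j))"
        using elim(1) unfolding is_cmat_eigvec_def cmat_eigs_def by blast
      show "card (cmat_eigs N (\<lambda>i j. d i * of_real (Weps W \<epsilon> i j))) \<le> card ((\<lambda>l. lam l \<epsilon>) ` I)"
        using finite_card_cmat_eigs(2) by (simp add: card_image[OF inj]) (simp add: I_def)
    qed (rule finite_card_cmat_eigs)
    with inj elim(1) show ?case by blast
  qed
  then show ?thesis
    using f_lim lam_lim unfolding I_def by (intro exI[of _ f] exI[of _ lam] conjI ballI allI)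
qed

text \<open>Eigenbases of the compressions to the level sets are glued. Each is extended by zero, so
  vectors from different level sets have disjoint supports and sums over \<open>I\<close> collapse
  to sums over one level set.\<close>

lemma level_set_eigenbasis:
  fixes d :: "nat \<Rightarrow> complex" and W :: "nat \<Rightarrow> nat \<Rightarrow> real"
  assumes fin: "finite I" and sym: "\<And>i j. i \<in> I \<Longrightarrow> j \<in> I \<Longrightarrow> W i j = W j i"
    and card: "\<And>l. l \<in> I \<Longrightarrow> card (real_eigs_on {m\<in>I. d m = d l} W) = card {m\<in>I. d m = d l}"
  shows "\<exists>(\<phi> :: nat \<Rightarrow> nat \<Rightarrow> real) \<mu>.
    (\<forall>l\<in>I. \<forall>m\<in>I. (\<Sum>i\<in>I. \<phi> l i * \<phi> m i) = (if l = m then 1 else 0)) \<and>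
    (\<forall>l\<in>I. \<forall>i\<in>I. d i \<noteq> d l \<longrightarrow> \<phi> l i = 0) \<and>
    (\<forall>l\<in>I. \<forall>i\<in>I. d i = d l \<longrightarrow> (\<Sum>j\<in>I. W i j * \<phi> l j) = \<mu> l * \<phi> l i) \<and>
    (\<forall>l\<in>I. \<forall>m\<in>I. l \<noteq> m \<longrightarrow> d l = d m \<longrightarrow> \<mu> l \<noteq> \<mu> m)"
proof -
  define C where "C z = {m\<in>I. d m = z}" for z
  \<comment> \<open>The choice is made per value \<open>z\<close> and not per index
    \<open>l\<close>: all members of a level set must come from the same eigenbasis to be mutually
    orthogonal.\<close>
  have "\<forall>z\<in>d ` I. \<exists>\<phi> \<mu>. inj_on \<mu> (C z) \<and> (\<forall>l\<in>C z. \<forall>i. i \<notin> C z \<longrightarrow> \<phi> l i = 0) \<and>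
      (\<forall>l\<in>C z. \<forall>m\<in>C z. (\<Sum>i\<in>C z. \<phi> l i * \<phi> m i) = (if l = m then 1 else 0)) \<and>
      (\<forall>l\<in>C z. \<forall>i\<in>C z. (\<Sum>j\<in>C z. W i j * \<phi> l j) = \<mu> l * \<phi> l i)"
  proof
    fix z assume "z \<in> d ` I"
    then have card_C: "card (real_eigs_on (C z) W) = card (C z)" using card by (auto simp: C_def)
    have fin_C: "finite (C z)" using fin by (simp add: C_def)
    have sym_C: "W i j = W j i" if "i \<in> C z" "j \<in> C z" for i j
      using sym that by (simp add: C_def)
    show "\<exists>\<phi> \<mu>. inj_on \<mu> (C z) \<and> (\<forall>l\<in>C z. \<forall>i. i \<notin> C z \<longrightarrow> \<phi> l i = 0) \<and>
      (\<forall>l\<in>C z. \<forall>m\<in>C z. (\<Sum>i\<in>C z. \<phi> l i * \<phi> m i) = (if l = m then 1 else 0)) \<and>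
      (\<forall>l\<in>C z. \<forall>i\<in>C z. (\<Sum>j\<in>C z. W i j * \<phi> l j) = \<mu> l * \<phi> l i)"
      by (rule distinct_eigs_orthonormal_eigenbasis[OF fin_C sym_C card_C])
  qed
  from bchoice[OF this] obtain \<Phi> where "\<forall>z\<in>d ` I. \<exists>\<mu>. inj_on \<mu> (C z) \<and>
      (\<forall>l\<in>C z. \<forall>i. i \<notin> C z \<longrightarrow> \<Phi> z l i = 0) \<and>
      (\<forall>l\<in>C z. \<forall>m\<in>C z. (\<Sum>i\<in>C z. \<Phi> z l i * \<Phi> z m i) = (if l = m then 1 else 0)) \<and>
      (\<forall>l\<in>C z. \<forall>i\<in>C z. (\<Sum>j\<in>C z. W i j * \<Phi> z l j) = \<mu> l * \<Phi> z l i)" by blast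
  from bchoice[OF this] obtain \<mu> where inj: "\<And>z. z \<in> d ` I \<Longrightarrow> inj_on (\<mu> z) (C z)"
    and supp: "\<And>z l i. z \<in> d ` I \<Longrightarrow> l \<in> C z \<Longrightarrow> i \<notin> C z \<Longrightarrow> \<Phi> z l i = 0"
    and orth: "\<And>z l m. z \<in> d ` I \<Longrightarrow> l \<in> C z \<Longrightarrow> m \<in> C z \<Longrightarrow>
      (\<Sum>i\<in>C z. \<Phi> z l i * \<Phi> z m i) = (if l = m then 1 else 0)"
    and eig: "\<And>z l i. z \<in> d ` I \<Longrightarrow> l \<in> C z \<Longrightarrow> i \<in> C z \<Longrightarrow>
      (\<Sum>j\<in>C z. W i j * \<Phi> z l j) = \<mu> z l * \<Phi> z l i" by blast
  have CI: "C z \<subseteq> I" for z by (auto simp: C_def)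
  have lC: "l \<in> C (d l)" if "l \<in> I" for l using that by (simp add: C_def)
  show ?thesis
  proof (intro exI[of _ "\<lambda>l. \<Phi> (d l) l"] exI[of _ "\<lambda>l. \<mu> (d l) l"] conjI ballI impI)
    fix l m assume lm: "l \<in> I" "m \<in> I"
    show "(\<Sum>i\<in>I. \<Phi> (d l) l i * \<Phi> (d m) m i) = (if l = m then 1 else 0)"
    proof (cases "d l = d m")
      case True
      have "(\<Sum>i\<in>I. \<Phi> (d l) l i * \<Phi> (d m) m i) = (\<Sum>i\<in>C (d l). \<Phi> (d l) l i * \<Phi> (d m) m i)"
        using supp[OF _ lC] lm fin CI by (intro sum.mono_neutral_right) auto
      then show ?thesis using orth[of "d l" l m] lm True lC[of l] lC[of m] by simp
    next
      case False
      have "\<Phi> (d l) l i * \<Phi> (d m) m i = 0" if "i \<in> I" for i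
        using supp[OF _ lC[OF lm(1)], of i] supp[OF _ lC[OF lm(2)], of i] False lm
        by (cases "d i = d l") (auto simp: C_def)
      then have "(\<Sum>i\<in>I. \<Phi> (d l) l i * \<Phi> (d m) m i) = 0" by (intro sum.neutral ballI)
      then show ?thesis using False by auto
    qed
    assume "l \<noteq> m" "d l = d m"
    then show "\<mu> (d l) l \<noteq> \<mu> (d m) m"
      using inj[of "d l"] lm lC[of l] lC[of m] by (auto simp: inj_on_def)
  next
    fix l i assume l: "l \<in> I" and i: "i \<in> I"
    show "\<Phi> (d l) l i = 0" if "d i \<noteq> d l"
      using supp[OF _ lC] l that by (auto simp: C_def)
    show "(\<Sum>j\<in>I. W i j * \<Phi> (d l) l j) = \<mu> (d l) l * \<Phi> (d l) l i" if "d i = d l"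
    proof -
      have "(\<Sum>j\<in>I. W i j * \<Phi> (d l) l j) = (\<Sum>j\<in>C (d l). W i j * \<Phi> (d l) l j)"
        using supp[OF _ lC] l fin CI by (intro sum.mono_neutral_right) auto
      then show ?thesis using eig[of "d l" l i] l i that lC[of l] lC[of i] by simp
    qed
  qed
qed

section \<open>Projections onto a Fourier mode\<close>

lemma exp_ikx_mult_cnj:
  "exp (2 * pi * \<i> * of_int k * of_real x) * cnj (exp (2 * pi * \<i> * of_int k * of_real x)) = 1"
  by (simp add: exp_cnj flip: exp_add)

definition fourier_coeff :: "int \<Rightarrow> (real \<Rightarrow> complex) \<Rightarrow> complex" where
  "fourier_coeff k g = (LINT x:{0..<1}|lborel. g x * cnj (exp (2 * pi * \<i> * of_int k * of_real x)))"

lemma L2inner_efun_right: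
  "L2inner N G (efun k f) = (1 / of_nat N) * (\<Sum>i\<in>{1..N}. cnj (f i) * fourier_coeff k (G i))"
proof -
  have "(LINT x:{0..<1}|lborel. G i x * cnj (efun k f i x)) = cnj (f i) * fourier_coeff k (G i)" for i
  proof -
    have "(LINT x:{0..<1}|lborel. G i x * cnj (efun k f i x)) =
        (LINT x:{0..<1}|lborel. cnj (f i) * (G i x * cnj (exp (2 * pi * \<i> * of_int k * of_real x))))"
      by (simp add: efun_def mult_ac)
    then show ?thesis by (simp add: fourier_coeff_def)
  qed
  then show ?thesis by (simp add: L2inner_def)
qed

lemma fourier_coeff_efun: "fourier_coeff k (efun k f j) = f j"
proof -
  have "efun k f j x * cnj (exp (2 * pi * \<i> * of_int k * of_real x)) = f j" for x
    unfolding efun_def by (metis exp_ikx_mult_cnj mult.assoc mult.right_neutral)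
  then have "fourier_coeff k (efun k f j) = (LINT x:{0..<1::real}|lborel. f j)"
    by (simp only: fourier_coeff_def)
  also have "\<dots> = f j" by (simp add: set_lebesgue_integral_def)
  finally show ?thesis .
qed

lemma L2inner_efun_efun: "L2inner N (efun k g) (efun k f) = (1 / of_nat N) * cinner N g f"
  unfolding L2inner_efun_right fourier_coeff_efun cinner_def by (simp add: mult.commute)

lemma L2norm_efun: "L2norm N (efun k a) = sqrt ((\<Sum>j\<in>{1..N}. (cmod (a j))\<^sup>2) / N)"
proof -
  have "cinner N a a = of_real (\<Sum>j\<in>{1..N}. (cmod (a j))\<^sup>2)"
    unfolding cinner_def of_real_sum by (intro sum.cong refl) (metis complex_norm_square of_real_power)
  then show ?thesis by (simp add: L2norm_def L2inner_efun_efun Re_divide_of_nat)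
qed

text \<open>The weight \<open>1 / N\<close> is at most 1, and the Euclidean norm is at most the sum
  of moduli, which is convenient for entrywise limits.\<close>

lemma L2norm_efun_le:
  assumes "1 \<le> N"
  shows "L2norm N (efun k a) \<le> (\<Sum>j\<in>{1..N}. cmod (a j))"
proof -
  have "(\<Sum>j\<in>{1..N}. (cmod (a j))\<^sup>2) / N \<le> (\<Sum>j\<in>{1..N}. (cmod (a j))\<^sup>2) / 1"
    using assms by (intro divide_left_mono) (auto intro: sum_nonneg)
  then have "L2norm N (efun k a) \<le> L2_set (\<lambda>j. cmod (a j)) {1..N}"
    unfolding L2norm_efun L2_set_def by (intro real_sqrt_le_mono) simp
  also have "\<dots> \<le> (\<Sum>j\<in>{1..N}. cmod (a j))" by (rule L2_set_le_sum) auto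
  finally show ?thesis .
qed

text \<open>The factors \<open>1 / N\<close> of the two inner products cancel, leaving the rank one
  matrix \<open>f f* / |f|^2\<close> applied to the vector of \<open>k\<close>-th Fourier
  coefficients of \<open>G\<close>.\<close>

lemma projL2_efun:
  assumes "1 \<le> N"
  shows "projL2 N (efun k f) G =
    efun k (\<lambda>j. \<Sum>i\<in>{1..N}. (f j * cnj (f i) / cinner N f f) * fourier_coeff k (G i))"
proof (intro ext)
  fix j x
  have "projL2 N (efun k f) G j x =
      (\<Sum>i\<in>{1..N}. cnj (f i) * fourier_coeff k (G i)) / cinner N f f * efun k f j x"
    unfolding projL2_def L2inner_efun_efun L2inner_efun_right[of N G] using assms by simp
  then show "projL2 N (efun k f) G j x =
    efun k (\<lambda>j. \<Sum>i\<in>{1..N}. (f j * cnj (f i) / cinner N f f) * fourier_coeff k (G i)) j x"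
    by (simp add: efun_def sum_distrib_left sum_distrib_right sum_divide_distrib mult_ac)
qed

text \<open>The bound comes from \<open>2 |g| \<le> 1 + |g|\<^sup>2\<close>; it is far from sharp, but any bound that is
  uniform over the unit ball suffices.\<close>

lemma fourier_coeff_bound:
  assumes G: "G \<in> L2space N" "L2norm N G \<le> 1" and j: "j \<in> {1..N}"
  shows "cmod (fourier_coeff k (G j)) \<le> (1 + real N) / 2"
proof -
  define n where "n i = (LINT x:{0..<1}|lborel. (cmod (G i x))\<^sup>2)" for i
  have n0: "0 \<le> n i" for i
    unfolding n_def set_lebesgue_integral_def by (intro integral_nonneg_AE) auto
  have "(LINT x:{0..<1}|lborel. G i x * cnj (G i x)) = of_real (n i)" for i
  proof -
    have "(LINT x:{0..<1}|lborel. G i x * cnj (G i x))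
        = (LINT x:{0..<1}|lborel. complex_of_real ((cmod (G i x))\<^sup>2))"
      by (simp only: complex_norm_square)
    then show ?thesis by (simp only: n_def set_integral_complex_of_real)
  qed
  then have "L2inner N G G = of_real ((\<Sum>i\<in>{1..N}. n i) / N)" by (simp add: L2inner_def)
  then have "sqrt ((\<Sum>i\<in>{1..N}. n i) / N) \<le> 1" using G(2) by (simp add: L2norm_def)
  \<comment> \<open>The probability weight makes the squared norm an average over the
    \<open>N\<close> circles, so a single circle can carry at most \<open>N\<close>.\<close>
  then have "(\<Sum>i\<in>{1..N}. n i) \<le> N" using j by (simp add: divide_simps)
  then have nN: "n j \<le> N" using member_le_sum[OF j, of n] n0 by force
  have int: "set_integrable lborel {0..<1} (\<lambda>x. (cmod (G j x))\<^sup>2)"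
    using G(1) j by (simp add: L2space_def)
  have int2: "set_integrable lborel {0..<1} (\<lambda>x. (1 + (cmod (G j x))\<^sup>2) / 2)"
    by (intro set_integrable_divide set_integral_add int) (simp add: set_integrable_def)
  have "cmod (fourier_coeff k (G j)) \<le> (LINT x:{0..<1}|lborel. cmod (G j x))"
  proof -
    have "cmod (fourier_coeff k (G j)) \<le> (LINT x|lborel. cmod (indicator {0..<1} x *\<^sub>R
        (G j x * cnj (exp (2 * pi * \<i> * of_int k * of_real x)))))"
      unfolding fourier_coeff_def set_lebesgue_integral_def by (rule integral_norm_bound)
    also have "\<dots> = (LINT x:{0..<1}|lborel. cmod (G j x))"
      unfolding set_lebesgue_integral_def
      by (intro Bochner_Integration.integral_cong refl) (simp add: norm_mult indicator_def)
    finally show ?thesis .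
  qed
  also have "\<dots> \<le> (LINT x:{0..<1}|lborel. (1 + (cmod (G j x))\<^sup>2) / 2)"
    unfolding set_lebesgue_integral_def
  proof (rule integral_mono')
    show "integrable lborel (\<lambda>x. indicator {0..<1} x *\<^sub>R ((1 + (cmod (G j x))\<^sup>2) / 2))"
      using int2 by (simp add: set_integrable_def)
    fix x :: real
    have "cmod (G j x) \<le> (1 + (cmod (G j x))\<^sup>2) / 2"
      using zero_le_power2[of "cmod (G j x) - 1"] by (simp add: power2_diff)
    then show "indicator {0..<1} x *\<^sub>R cmod (G j x)
        \<le> indicator {0..<1} x *\<^sub>R ((1 + (cmod (G j x))\<^sup>2) / 2)"
      by (simp add: indicator_def)
  qed (auto simp: indicator_def)
  also have "\<dots> = (1 + n j) / 2"
  proof -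
    have "(LINT x:{0..<1::real}|lborel. 1 + (cmod (G j x))\<^sup>2) = 1 + n j"
      using int by (subst set_integral_add) (auto simp: n_def set_integrable_def set_lebesgue_integral_def)
    then show ?thesis by simp
  qed
  finally show ?thesis using nN by simp
qed

text \<open>On the unit ball the Fourier coefficients are uniformly bounded, so the operator norm is
  controlled by the entries of the difference of the rank one matrices \<open>p\<close>. These
  entries depend continuously on the vector wherever its norm is nonzero.\<close>

lemma opnormL2_projL2_efun_tendsto_0:
  assumes N: "1 \<le> N" and lim: "\<And>j. j \<in> {1..N} \<Longrightarrow> ((\<lambda>\<epsilon>. f \<epsilon> j) \<longlongrightarrow> f0 j) F"
    and f0: "cinner N f0 f0 \<noteq> 0"
  shows "((\<lambda>\<epsilon>. opnormL2 N (\<lambda>G j x. projL2 N (efun k (f \<epsilon>)) G j x - projL2 N (efun k f0) G j x))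
    \<longlongrightarrow> 0) F"
proof -
  define p where "p g j i = g j * cnj (g i) / cinner N g g" for g j i
  define b where "b \<epsilon> = (\<Sum>j\<in>{1..N}. \<Sum>i\<in>{1..N}. cmod (p (f \<epsilon>) j i - p f0 j i) * ((1 + real N) / 2))" for \<epsilon>
  have b: "0 \<le> opnormL2 N (\<lambda>G j x. projL2 N (efun k (f \<epsilon>)) G j x - projL2 N (efun k f0) G j x) \<and>
     opnormL2 N (\<lambda>G j x. projL2 N (efun k (f \<epsilon>)) G j x - projL2 N (efun k f0) G j x) \<le> b \<epsilon>" for \<epsilon>
  proof -
    define T where "T = (\<lambda>G j x. projL2 N (efun k (f \<epsilon>)) G j x - projL2 N (efun k f0) G j x)"
    define a where "a G j = (\<Sum>i\<in>{1..N}. (p (f \<epsilon>) j i - p f0 j i) * fourier_coeff k (G i))" for G j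
    have T: "T G = efun k (a G)" for G
      unfolding T_def projL2_efun[OF N]
      by (intro ext) (simp add: efun_def a_def p_def sum_subtractf left_diff_distrib)
    have ub: "L2norm N (T G) \<le> b \<epsilon>" if "G \<in> L2space N" "L2norm N G \<le> 1" for G
    proof -
      have "L2norm N (T G) \<le> (\<Sum>j\<in>{1..N}. cmod (a G j))"
        unfolding T by (rule L2norm_efun_le[OF N])
      also have "\<dots> \<le> b \<epsilon>"
        unfolding b_def
      proof (rule sum_mono)
        fix j assume "j \<in> {1..N}"
        have "cmod (a G j) \<le> (\<Sum>i\<in>{1..N}. cmod ((p (f \<epsilon>) j i - p f0 j i) * fourier_coeff k (G i)))"
          unfolding a_def by (rule norm_sum)
        also have "\<dots> \<le> (\<Sum>i\<in>{1..N}. cmod (p (f \<epsilon>) j i - p f0 j i) * ((1 + real N) / 2))"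
          unfolding norm_mult
          by (intro sum_mono mult_left_mono fourier_coeff_bound[OF that] norm_ge_zero)
        finally show "cmod (a G j) \<le> (\<Sum>i\<in>{1..N}. cmod (p (f \<epsilon>) j i - p f0 j i) * ((1 + real N) / 2))" .
      qed
      finally show ?thesis .
    qed
    \<comment> \<open>The zero function makes the set under \<open>Sup\<close> nonempty; together
      with the upper bound \<open>ub\<close> this gives the real supremum its usual meaning.\<close>
    have zero: "(\<lambda>_ _. 0) \<in> L2space N" "L2norm N (\<lambda>_ _. 0) \<le> 1"
      by (auto simp: L2space_def set_borel_measurable_def set_integrable_def L2norm_def L2inner_def)
    have nonneg: "0 \<le> L2norm N (T G)" for G
      unfolding T L2norm_efun by (simp add: sum_nonneg)
    have "0 \<le> opnormL2 N T"
      unfolding opnormL2_def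
    proof (rule cSup_upper2[OF _ nonneg])
      show "L2norm N (T (\<lambda>_ _. 0)) \<in> {L2norm N (T G) |G. G \<in> L2space N \<and> L2norm N G \<le> 1}"
        using zero by blast
      show "bdd_above {L2norm N (T G) |G. G \<in> L2space N \<and> L2norm N G \<le> 1}"
        using ub by (intro bdd_aboveI[of _ "b \<epsilon>"]) blast
    qed
    moreover have "opnormL2 N T \<le> b \<epsilon>"
      unfolding opnormL2_def by (rule cSup_least) (use zero ub in blast)+
    ultimately show ?thesis by (simp add: T_def)
  qed
  have "(b \<longlongrightarrow> (\<Sum>j\<in>{1..N}. \<Sum>i\<in>{1..N}. cmod (p f0 j i - p f0 j i) * ((1 + real N) / 2))) F"
    unfolding b_def[abs_def] p_def cinner_def
    by (intro tendsto_intros lim) (use f0 in \<open>auto simp: cinner_def\<close>)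
  then have "(b \<longlongrightarrow> 0) F" by simp
  then show ?thesis
    by (rule tendsto_sandwich[OF _ _ tendsto_const, rotated 2]) (use b in auto)
qed

section \<open>Bands\<close>

lemma Nsum_mono: "s \<le> t \<Longrightarrow> Nsum L s \<le> Nsum L t"
  unfolding Nsum_def by (rule sum_mono2) auto

lemma band_unique:
  assumes "j \<in> band L s" "j \<in> band L t" "1 \<le> s" "1 \<le> t"
  shows "s = t"
proof (rule ccontr)
  assume "s \<noteq> t"
  then consider "s \<le> t - 1" | "t \<le> s - 1" using assms(3,4) by linarith
  then show False
    using Nsum_mono[of s "t - 1" L] Nsum_mono[of t "s - 1" L] assms(1,2)
    by cases (auto simp: band_def)
qed

lemma band_cover:
  assumes "bandwidth_vector N S L" "j \<in> {1..N}"
  obtains s where "s \<in> {1..S}" "j \<in> band L s"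
proof -
  define s where "s = (LEAST s. j \<le> Nsum L s)"
  have S: "j \<le> Nsum L S" using assms by (simp add: bandwidth_vector_def Nsum_def)
  have s: "j \<le> Nsum L s" unfolding s_def using S by (rule LeastI)
  \<comment> \<open>\<open>Nsum L 0 = 0\<close> lies below \<open>j\<close>, so \<open>s - 1\<close>
    is a true predecessor and minimality of \<open>s\<close> applies to it.\<close>
  have "s \<noteq> 0" using s assms(2) by (intro notI) (simp add: Nsum_def)
  moreover have "s \<le> S" unfolding s_def using S by (rule Least_le)
  moreover have "\<not> j \<le> Nsum L (s - 1)"
    using \<open>s \<noteq> 0\<close> not_less_Least[of "s - 1" "\<lambda>s. j \<le> Nsum L s"] by (simp add: s_def)
  ultimately show ?thesis using that[of s] s by (simp add: band_def)
qed

lemma card_band: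
  assumes "1 \<le> s"
  shows "card (band L s) = L s"
proof -
  have "band L s = {Nsum L (s - 1)<..Nsum L s}" by (auto simp: band_def)
  moreover have "Nsum L s = Nsum L (s - 1) + L s"
    using assms by (cases s) (simp_all add: Nsum_def)
  ultimately show ?thesis by simp
qed

lemma band_subset:
  assumes "bandwidth_vector N S L" "s \<in> {1..S}"
  shows "band L s \<subseteq> {1..N}"
  using Nsum_mono[of s S L] assms by (auto simp: band_def bandwidth_vector_def Nsum_def)

text \<open>Translation by \<open>\<alpha> j\<close> multiplies the \<open>k\<close>-th exponential
  by the diagonal entry \<open>Dka k \<alpha> j\<close>. On the \<open>k\<close>-th mode the
  transfer operator is therefore the matrix \<open>DW k \<alpha> W\<close>.\<close>

lemma transfer_efun:
  "transfer N \<alpha> W (efun k f) j x =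
    (\<Sum>j'\<in>{1..N}. DW k \<alpha> W j j' * f j') * exp (2 * pi * \<i> * of_int k * of_real x)"
proof -
  have shift: "exp (2 * pi * \<i> * of_int k * of_real (x - \<alpha> j)) =
      Dka k \<alpha> j * exp (2 * pi * \<i> * of_int k * of_real x)"
    unfolding Dka_def by (simp add: algebra_simps flip: exp_add)
  show ?thesis
    unfolding transfer_def efun_def DW_def shift sum_distrib_right
    by (intro sum.cong refl) (simp add: mult_ac)
qed

theorem theorem2p5:
  fixes N S :: nat and L :: "nat \<Rightarrow> nat" and Wd :: "nat \<Rightarrow> nat \<Rightarrow> real"
    and \<beta> \<alpha> :: "nat \<Rightarrow> real" and k :: int
  assumes "1 \<le> N" and "1 \<le> S" and "S \<le> N"
    and "bandwidth_vector N S L"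
    and "L_admissible N S L Wd"
    and "Gamma_set S \<beta>"
    and "\<forall>s\<in>{1..S}. \<forall>j\<in>band L s. \<alpha> j = \<beta> s"
  shows "\<exists>(f :: nat \<Rightarrow> real \<Rightarrow> nat \<Rightarrow> complex) (lam :: nat \<Rightarrow> real \<Rightarrow> complex)
            (f0 :: nat \<Rightarrow> nat \<Rightarrow> complex).
     (\<forall>\<^sub>F \<epsilon> in at_right 0.
        (\<forall>l\<in>{1..N}. (\<exists>j\<in>{1..N}. f l \<epsilon> j \<noteq> 0) \<and>
           (\<forall>j\<in>{1..N}. \<forall>x. transfer N \<alpha> (Weps Wd \<epsilon>) (efun k (f l \<epsilon>)) j x
                              = lam l \<epsilon> * efun k (f l \<epsilon>) j x) \<and>
           is_cmat_eigvec N (DW k \<alpha> (Weps Wd \<epsilon>)) (f l \<epsilon>) (lam l \<epsilon>)) \<and>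
        inj_on (\<lambda>l. lam l \<epsilon>) {1..N} \<and>
        (\<lambda>l. lam l \<epsilon>) ` {1..N} = cmat_eigs N (DW k \<alpha> (Weps Wd \<epsilon>))) \<and>
     (\<forall>l\<in>{1..N}. ((\<lambda>\<epsilon>. lam l \<epsilon>) \<longlongrightarrow> exp (- 2 * pi * \<i> * of_int k * of_real (\<alpha> l))) (at_right 0)) \<and>
     (\<forall>l\<in>{1..N}. \<forall>l'\<in>{1..N}. cinner N (f0 l) (f0 l') = (if l = l' then 1 else 0)) \<and>
     (\<forall>l\<in>{1..N}. ((\<lambda>\<epsilon>. opnormL2 N (\<lambda>G j x. projL2 N (efun k (f l \<epsilon>)) G j x
                                          - projL2 N (efun k (f0 l)) G j x)) \<longlongrightarrow> 0) (at_right 0)) \<and>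
     ((S = 1 \<or> k = 0) \<longrightarrow>
        (\<forall>l\<in>{1..N}. \<exists>\<mu>. is_cmat_eigvec N (\<lambda>i j. of_real (Wd i j)) (f0 l) \<mu>)) \<and>
     ((1 < S \<and> k \<noteq> 0) \<longrightarrow>
        (\<forall>l\<in>{1..N}. \<exists>\<mu>. is_cmat_eigvec N (Phat k S L \<beta> Wd) (f0 l) \<mu>) \<and>
        (\<forall>s\<in>{1..S}. \<forall>l\<in>band L s. \<forall>j\<in>{1..N}. j \<notin> band L s \<longrightarrow> f0 l j = 0))"
proof -
  note bw = \<open>bandwidth_vector N S L\<close>
  define d where "d = Dka k \<alpha>"
  have d_band: "d j = exp (- 2 * pi * \<i> * of_int k * of_real (\<beta> s))"
    if "s \<in> {1..S}" "j \<in> band L s" for s j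
    using that assms(7) by (simp add: d_def Dka_def)
  have sym: "Wd i j = Wd j i" if "i \<in> {1..N}" "j \<in> {1..N}" for i j
    using assms(5) that unfolding L_admissible_def by blast
  have d_const: "d m = d l" if "S = 1 \<or> k = 0" "m \<in> {1..N}" "l \<in> {1..N}" for l m
  proof (cases "k = 0")
    case True
    then show ?thesis by (simp add: d_def Dka_def)
  next
    case False
    with that have "S = 1" by simp
    obtain s t where st: "s \<in> {1..S}" "m \<in> band L s" "t \<in> {1..S}" "l \<in> band L t"
      using band_cover[OF bw \<open>m \<in> {1..N}\<close>] band_cover[OF bw \<open>l \<in> {1..N}\<close>] by metis
    with \<open>S = 1\<close> have "s = t" by simp
    with d_band[OF st(1,2)] d_band[OF st(3,4)] show ?thesis by simp
  qed
  \<comment> \<open>For nonzero \<open>k\<close> the condition on \<open>\<beta>\<close> gives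
    different bands different phases, so the level sets of \<open>d\<close> are exactly the
    bands.\<close>
  have level: "{m\<in>{1..N}. d m = d l} = band L s"
    if "\<not> (S = 1 \<or> k = 0)" "s \<in> {1..S}" "l \<in> band L s" for s l
  proof (intro equalityI subsetI)
    fix m assume "m \<in> band L s"
    then show "m \<in> {m\<in>{1..N}. d m = d l}"
      using band_subset[OF bw that(2)] d_band[OF that(2)] that(3) by auto
  next
    fix m assume m: "m \<in> {m\<in>{1..N}. d m = d l}"
    then obtain t where t: "t \<in> {1..S}" "m \<in> band L t" using band_cover[OF bw] by blast
    have "exp (- 2 * pi * \<i> * of_int k * of_real (\<beta> t)) = exp (- 2 * pi * \<i> * of_int k * of_real (\<beta> s))"
      using m d_band[OF t] d_band[OF that(2,3)] by simp
    then have "t = s" using assms(6) that(1,2) t(1) unfolding Gamma_set_def by blast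
    then show "m \<in> band L s" using t(2) by simp
  qed
  \<comment> \<open>Admissibility provides distinct eigenvalues for the full matrix when
    \<open>d\<close> is constant, and for the diagonal block of the band otherwise.\<close>
  have card: "card (real_eigs_on {m\<in>{1..N}. d m = d l} Wd) = card {m\<in>{1..N}. d m = d l}"
    if l: "l \<in> {1..N}" for l
  proof (cases "S = 1 \<or> k = 0")
    case True
    then have "{m\<in>{1..N}. d m = d l} = {1..N}" using d_const l by blast
    then show ?thesis using assms(5) by (simp add: L_admissible_def)
  next
    case False
    obtain s where s: "s \<in> {1..S}" "l \<in> band L s" using band_cover[OF bw l] .
    have "card (real_eigs_on (band L s) Wd) = L s"
      using assms(5) s(1) unfolding L_admissible_def by blast
    then show ?thesis using level[OF False s] card_band[of s L] s(1) by simp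
  qed
  obtain \<phi> \<mu> where
    "\<forall>l\<in>{1..N}. \<forall>m\<in>{1..N}. (\<Sum>i\<in>{1..N}. \<phi> l i * \<phi> m i) = (if l = m then 1 else 0)"
    "\<forall>l\<in>{1..N}. \<forall>i\<in>{1..N}. d i \<noteq> d l \<longrightarrow> \<phi> l i = 0"
    "\<forall>l\<in>{1..N}. \<forall>i\<in>{1..N}. d i = d l \<longrightarrow> (\<Sum>j\<in>{1..N}. Wd i j * \<phi> l j) = \<mu> l * \<phi> l i"
    "\<forall>l\<in>{1..N}. \<forall>m\<in>{1..N}. l \<noteq> m \<longrightarrow> d l = d m \<longrightarrow> \<mu> l \<noteq> \<mu> m"
    by (atomize_elim, rule level_set_eigenbasis[OF finite_atLeastAtMost sym card])
  note orth = this(1)[rule_format] and supp = this(2)[rule_format]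
    and eig = this(3)[rule_format] and dist = this(4)[rule_format]
  have d0: "d l \<noteq> 0" for l by (simp add: d_def Dka_def)
  obtain f lam where
    f_lim: "\<forall>l\<in>{1..N}. \<forall>j. ((\<lambda>\<epsilon>. f l \<epsilon> j) \<longlongrightarrow> of_real (\<phi> l j)) (at_right 0)"
    and lam_lim: "\<forall>l\<in>{1..N}. (lam l \<longlongrightarrow> d l) (at_right 0)"
    and ev: "\<forall>\<^sub>F \<epsilon> in at_right 0.
      (\<forall>l\<in>{1..N}. is_cmat_eigvec N (\<lambda>i j. d i * of_real (Weps Wd \<epsilon> i j)) (f l \<epsilon>) (lam l \<epsilon>)) \<and>
      inj_on (\<lambda>l. lam l \<epsilon>) {1..N} \<and>
      (\<lambda>l. lam l \<epsilon>) ` {1..N} = cmat_eigs N (\<lambda>i j. d i * of_real (Weps Wd \<epsilon> i j))"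
    by (atomize_elim, rule perturbed_eigensystem[OF d0 orth supp eig dist])
  define f0 where "f0 l j = complex_of_real (\<phi> l j)" for l j
  have DW: "(\<lambda>i j. d i * of_real (Weps Wd \<epsilon> i j)) = DW k \<alpha> (Weps Wd \<epsilon>)" for \<epsilon>
    by (intro ext) (simp add: DW_def d_def)
  have inner: "cinner N (f0 l) (f0 m) = (if l = m then 1 else 0)" if "l \<in> {1..N}" "m \<in> {1..N}" for l m
  proof -
    have "cinner N (f0 l) (f0 m) = of_real (\<Sum>i\<in>{1..N}. \<phi> l i * \<phi> m i)"
      by (simp add: cinner_def f0_def)
    then show ?thesis unfolding orth[OF that] by simp
  qed
  have f0_nz: "\<exists>i\<in>{1..N}. f0 l i \<noteq> 0" if "l \<in> {1..N}" for l
  proof (rule ccontr)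
    assume "\<not> (\<exists>i\<in>{1..N}. f0 l i \<noteq> 0)"
    then have "cinner N (f0 l) (f0 l) = 0" by (simp add: cinner_def)
    then show False using inner[OF that that] by simp
  qed
  have f0_eig: "(\<Sum>j\<in>{1..N}. of_real (Wd i j) * f0 l j) = of_real (\<mu> l) * f0 l i"
    if "l \<in> {1..N}" "i \<in> {1..N}" "d i = d l" for l i
    using arg_cong[OF eig[OF that], of complex_of_real] by (simp add: f0_def)
  have f0_supp: "f0 l j = 0"
    if "1 < S" "k \<noteq> 0" "s \<in> {1..S}" "l \<in> band L s" "j \<in> {1..N}" "j \<notin> band L s" for s l j
    using level[OF _ that(3,4)] supp[of l j] band_subset[OF bw that(3)] that by (auto simp: f0_def)
  have Phat_eig: "\<exists>\<mu>. is_cmat_eigvec N (Phat k S L \<beta> Wd) (f0 l) \<mu>"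
    if Sk: "1 < S" "k \<noteq> 0" and l: "l \<in> {1..N}" for l
  proof -
    obtain s where s: "s \<in> {1..S}" "l \<in> band L s" using band_cover[OF bw l] .
    have level_s: "{m\<in>{1..N}. d m = d l} = band L s" using level[OF _ s] Sk by simp
    \<comment> \<open>As \<open>f0 l\<close> lives on band \<open>s\<close>, rows in that band see
      only the block of \<open>Wd\<close>, where the eigenvalue \<open>\<mu> l\<close> is multiplied
      by the phase \<open>d l\<close>. In all other rows both sides vanish.\<close>
    have "(\<Sum>j\<in>{1..N}. Phat k S L \<beta> Wd i j * f0 l j) = d l * of_real (\<mu> l) * f0 l i"
      if i: "i \<in> {1..N}" for i
    proof -
      obtain t where t: "t \<in> {1..S}" "i \<in> band L t" using band_cover[OF bw i] .
      have "{s\<in>{1..S}. i \<in> band L s} = {t}" using t band_unique[of i L] by auto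
      then have Dkb: "Dkb k S L \<beta> i = d i" using d_band[OF t] by (simp add: Dkb_def)
      show ?thesis
      proof (cases "i \<in> band L s")
        case True
        have "Phat k S L \<beta> Wd i j * f0 l j = d i * (of_real (Wd i j) * f0 l j)" if "j \<in> {1..N}" for j
          using f0_supp[OF Sk s that] s True
          by (cases "j \<in> band L s") (auto simp: Phat_def What_def Dkb)
        then have "(\<Sum>j\<in>{1..N}. Phat k S L \<beta> Wd i j * f0 l j)
            = d i * (\<Sum>j\<in>{1..N}. of_real (Wd i j) * f0 l j)"
          unfolding sum_distrib_left by (intro sum.cong refl)
        moreover have "d i = d l" using True level_s by blast
        ultimately show ?thesis using f0_eig[OF l i] by simp
      next
        case False
        have "Phat k S L \<beta> Wd i j * f0 l j = 0" if "j \<in> {1..N}" for j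
        proof (cases "j \<in> band L s")
          case True
          have "\<not> (\<exists>t\<in>{1..S}. i \<in> band L t \<and> j \<in> band L t)"
          proof
            assume "\<exists>t\<in>{1..S}. i \<in> band L t \<and> j \<in> band L t"
            then obtain t where t: "t \<in> {1..S}" "i \<in> band L t" "j \<in> band L t" by blast
            then have "t = s" using band_unique[OF t(3) True] s(1) by simp
            then show False using t(2) False by simp
          qed
          then have "What S L Wd i j = 0" unfolding What_def by (rule if_not_P)
          then show ?thesis by (simp add: Phat_def)
        next
          case False
          then show ?thesis using f0_supp[OF Sk s that] by simp
        qed
        then have "(\<Sum>j\<in>{1..N}. Phat k S L \<beta> Wd i j * f0 l j) = 0" by (intro sum.neutral ballI)
        then show ?thesis using f0_supp[OF Sk s i False] by simp
      qed
    qed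
    then have "is_cmat_eigvec N (Phat k S L \<beta> Wd) (f0 l) (d l * of_real (\<mu> l))"
      unfolding is_cmat_eigvec_def using f0_nz[OF l] by blast
    then show ?thesis ..
  qed
  have "\<forall>\<^sub>F \<epsilon> in at_right 0.
        (\<forall>l\<in>{1..N}. (\<exists>j\<in>{1..N}. f l \<epsilon> j \<noteq> 0) \<and>
           (\<forall>j\<in>{1..N}. \<forall>x. transfer N \<alpha> (Weps Wd \<epsilon>) (efun k (f l \<epsilon>)) j x
                              = lam l \<epsilon> * efun k (f l \<epsilon>) j x) \<and>
           is_cmat_eigvec N (DW k \<alpha> (Weps Wd \<epsilon>)) (f l \<epsilon>) (lam l \<epsilon>)) \<and>
        inj_on (\<lambda>l. lam l \<epsilon>) {1..N} \<and>
        (\<lambda>l. lam l \<epsilon>) ` {1..N} = cmat_eigs N (DW k \<alpha> (Weps Wd \<epsilon>))"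
    using ev unfolding DW
    by eventually_elim (auto simp: is_cmat_eigvec_def transfer_efun, auto simp: efun_def)
  moreover have "\<forall>l\<in>{1..N}. ((\<lambda>\<epsilon>. lam l \<epsilon>) \<longlongrightarrow> exp (- 2 * pi * \<i> * of_int k * of_real (\<alpha> l))) (at_right 0)"
    using lam_lim by (simp add: d_def Dka_def)
  moreover have "\<forall>l\<in>{1..N}. ((\<lambda>\<epsilon>. opnormL2 N (\<lambda>G j x. projL2 N (efun k (f l \<epsilon>)) G j x
                                          - projL2 N (efun k (f0 l)) G j x)) \<longlongrightarrow> 0) (at_right 0)"
    by (intro ballI opnormL2_projL2_efun_tendsto_0[OF assms(1)])
      (use f_lim inner in \<open>auto simp: f0_def\<close>)
  moreover have "(S = 1 \<or> k = 0) \<longrightarrow>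
      (\<forall>l\<in>{1..N}. \<exists>\<mu>. is_cmat_eigvec N (\<lambda>i j. of_real (Wd i j)) (f0 l) \<mu>)"
  proof (intro impI ballI)
    fix l assume Sk: "S = 1 \<or> k = 0" and l: "l \<in> {1..N}"
    have "is_cmat_eigvec N (\<lambda>i j. of_real (Wd i j)) (f0 l) (of_real (\<mu> l))"
      unfolding is_cmat_eigvec_def using f0_nz[OF l] f0_eig[OF l] d_const[OF Sk _ l] by blast
    then show "\<exists>\<mu>. is_cmat_eigvec N (\<lambda>i j. of_real (Wd i j)) (f0 l) \<mu>" ..
  qed
  moreover have "(1 < S \<and> k \<noteq> 0) \<longrightarrow>
        (\<forall>l\<in>{1..N}. \<exists>\<mu>. is_cmat_eigvec N (Phat k S L \<beta> Wd) (f0 l) \<mu>) \<and>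
        (\<forall>s\<in>{1..S}. \<forall>l\<in>band L s. \<forall>j\<in>{1..N}. j \<notin> band L s \<longrightarrow> f0 l j = 0)"
    using Phat_eig f0_supp by blast
  moreover have "\<forall>l\<in>{1..N}. \<forall>l'\<in>{1..N}. cinner N (f0 l) (f0 l') = (if l = l' then 1 else 0)"
    using inner by blast
  ultimately show ?thesis by (intro exI[of _ f] exI[of _ lam] exI[of _ f0] conjI)
qed

end
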